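(* Let $\Gamma \subset \mathsf{Homeo}(M)$ be a non-elementary convergence group and let $\sigma\colon\Gamma\times M\to\mathbb{R}$ be an expanding coarse-cocycle with $\delta_\sigma(\Gamma) < +\infty$. If $G \subset \Gamma$ is a subgroup such that $\Lambda(G)$ is a strict subset of $\Lambda(\Gamma)$ and $$\sum_{g \in G} e^{-\delta_\sigma(G)\|g\|_\sigma}=+\infty,$$ then $\delta_\sigma(G) < \delta_\sigma(\Gamma)$.
   Context: Convergence groups. $M$ is a compact metrizable space. A subgroup $\Gamma\subset\mathsf{Homeo}(M)$ is a (discrete) convergence group if for every sequence $\{\gamma_n\}$ of distinct elements of $\Gamma$ there are $x,y\in M$ and a subsequence $\{\gamma_{n_j}\}$ such that $\gamma_{n_j}|_{M\smallsetminus\{y\}}$ converges locally uniformly to the constant $x$. The limit set $\Lambda(\Gamma)$ is the set of $x\in M$ for which there are $y\in M$ and a sequence $\{\gamma_n\}\subset\Gamma$ with $\gamma_n|_{M\smallsetminus\{y\}}\to x$ locally uniformly; $\Lambda(G)$ is defined in the same way using sequences in $G$. $\Gamma$ is non-elementary if $\#\Lambda(\Gamma)\ge 3$. An element $\gamma$ is loxodromic if it has two fixed points $\gamma^+\ne\gamma^-$ in $\Lambda(\Gamma)$ such that $\gamma^{\pm n}|_{M\smallsetminus\{\gamma^{\mp}\}}$ converges locally uniformly to $\gamma^{\pm}$ as $n\to+\infty$. Compatible metrics. $\Gamma\sqcup M$ carries a unique compact metrizable topology for which the inclusions of $\Gamma$ (discrete) and of $M$ are embeddings and the natural action of $\Gamma$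 (left multiplication on $\Gamma$) is a convergence group action. A compatible metric $\mathrm{d}$ is a metric on $\Gamma\sqcup M$ inducing this topology; fix one. Coarse-cocycles. For $\kappa\ge0$, $\sigma\colon\Gamma\times M\to\mathbb{R}$ is a $\kappa$-coarse-cocycle if (i) $\limsup_{x\to x_0}|\sigma(\gamma,x_0)-\sigma(\gamma,x)|\le\kappa$ for all $\gamma\in\Gamma$, $x_0\in M$, and (ii) $|\sigma(\gamma_1\gamma_2,x)-(\sigma(\gamma_1,\gamma_2x)+\sigma(\gamma_2,x))|\le\kappa$ for all $\gamma_1,\gamma_2\in\Gamma$, $x\in M$. A coarse-cocycle is a $\kappa$-coarse-cocycle for some $\kappa$. It is proper if $\sigma(\gamma_n,\gamma_n^+)\to+\infty$ whenever $\{\gamma_n\}\subset\Gamma$ is a sequence of distinct loxodromic elements with $\liminf_n\mathrm{d}(\gamma_n^-,\gamma_n^+)>0$. It is expanding if it is proper and for each $\gamma\in\Gamma$ there is a number $\|\gamma\|_\sigma\in\mathbb{R}$ (the $\sigma$-magnitude) such that for every $\epsilon>0$ there is $C>0$ with $\|\gamma\|_\sigma-C\le\sigma(\gamma,x)\le\|\gamma\|_\sigma+C$ whenever $x\in M$, $\gamma\in\Gamma$ and $\mathrm{d}(x,\gamma^{-1})>\epsilon$ (here $\gamma^{-1}$ is a point of $\Gamma\sqcup M$). The magnitude function is any fixed choice; two choices differ by a bounded amount. Critical exponents: for $H=\Gamma$ or $H=G$, $\delta_\sigma(H)=\inf\{s>0:\sum_{h\in H}e^{-s\|h\|_\sigma}<+\infty\}\in[0,+\infty]$.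 *)

theory Defs
  imports "HOL-Analysis.Analysis" "HOL-Algebra.Group"
begin

section \<open>Locally uniform convergence to a constant\<close>

text \<open>
  Uniform convergence to a \<^emph>\<open>constant\<close> map depends only on the topology near that constant, so the
  notion can be written for an arbitrary topology. The lemma below identifies it with the
  library's notion of uniform limit when the topology comes from a metric.
\<close>

definition loc_unif_to_const ::
    "'a topology \<Rightarrow> 'a set \<Rightarrow> (nat \<Rightarrow> 'a \<Rightarrow> 'a) \<Rightarrow> 'a \<Rightarrow> bool" where
  "loc_unif_to_const X A f x \<longleftrightarrow>
     (\<forall>p\<in>A. \<exists>V. openin X V \<and> p \<in> V \<and>
        (\<forall>U. openin X U \<and> x \<in> U \<longrightarrow> (\<forall>\<^sub>F n in sequentially. f n ` (V \<inter> A) \<subseteq> U)))"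

lemma loc_unif_to_const_iff_uniform_limit:
  fixes f :: "nat \<Rightarrow> 'm::metric_space \<Rightarrow> 'm"
  shows "loc_unif_to_const euclidean A f x \<longleftrightarrow>
     (\<forall>p\<in>A. \<exists>V. open V \<and> p \<in> V \<and> uniform_limit (V \<inter> A) f (\<lambda>_. x) sequentially)"
proof -
  have "(\<forall>U. open U \<and> x \<in> U \<longrightarrow> (\<forall>\<^sub>F n in sequentially. f n ` B \<subseteq> U))
        \<longleftrightarrow> uniform_limit B f (\<lambda>_. x) sequentially" for B
  proof
    assume L: "\<forall>U. open U \<and> x \<in> U \<longrightarrow> (\<forall>\<^sub>F n in sequentially. f n ` B \<subseteq> U)"
    show "uniform_limit B f (\<lambda>_. x) sequentially"
    proof (rule uniform_limitI)
      fix e :: real assume "e > 0"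
      then have "\<forall>\<^sub>F n in sequentially. f n ` B \<subseteq> ball x e"
        using L by simp
      then show "\<forall>\<^sub>F n in sequentially. \<forall>z\<in>B. dist (f n z) x < e"
        by eventually_elim (auto simp: dist_commute)
    qed
  next
    assume R: "uniform_limit B f (\<lambda>_. x) sequentially"
    show "\<forall>U. open U \<and> x \<in> U \<longrightarrow> (\<forall>\<^sub>F n in sequentially. f n ` B \<subseteq> U)"
    proof (intro allI impI)
      fix U assume "open U \<and> x \<in> U"
      then obtain e where e: "e > 0" "ball x e \<subseteq> U"
        using open_contains_ball by blast
      have "\<forall>\<^sub>F n in sequentially. \<forall>z\<in>B. dist (f n z) x < e"
        using uniform_limitD[OF R e(1)] .
      then show "\<forall>\<^sub>F n in sequentially. f n ` B \<subseteq> U"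
        by eventually_elim (use e(2) in \<open>auto simp: dist_commute subset_iff\<close>)
    qed
  qed
  then show ?thesis
    by (simp add: loc_unif_to_const_def)
qed


section \<open>Convergence groups\<close>

definition homeo_group :: "('m::topological_space \<Rightarrow> 'm) monoid" where
  "homeo_group = \<lparr>carrier = {f. homeomorphic_map euclidean euclidean f}, mult = (\<circ>), one = id\<rparr>"

lemma group_homeo_group: "group (homeo_group :: ('m::topological_space \<Rightarrow> 'm) monoid)"
proof (rule groupI)
  fix f :: "'m \<Rightarrow> 'm" assume "f \<in> carrier homeo_group"
  then obtain g where g: "homeomorphic_maps euclidean euclidean f g"
    by (auto simp: homeo_group_def homeomorphic_map_maps)
  then have "homeomorphic_map euclidean euclidean g"
    using homeomorphic_map_maps homeomorphic_maps_sym by blast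
  moreover have "g \<circ> f = id"
    using g by (auto simp: homeomorphic_maps_def)
  ultimately show "\<exists>g\<in>carrier homeo_group. g \<otimes>\<^bsub>homeo_group\<^esub> f = \<one>\<^bsub>homeo_group\<^esub>"
    by (auto simp: homeo_group_def)
qed (auto simp: homeo_group_def comp_assoc homeomorphic_map_id[unfolded id_def] id_def
       intro: homeomorphic_map_compose)

lemma inv_homeo_group:
  assumes "f \<in> carrier homeo_group"
  shows "inv\<^bsub>homeo_group\<^esub> f = inv_into UNIV f"
proof -
  have "inv\<^bsub>homeo_group\<^esub> f \<circ> f = id"
    using group.l_inv[OF group_homeo_group assms] by (simp add: homeo_group_def)
  moreover have "bij f"
    using assms by (simp add: homeo_group_def homeomorphic_eq_everything_map bij_def)
  ultimately show ?thesis
    by (metis bij_is_surj comp_assoc comp_id id_comp surj_iff)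
qed

definition convergence_property ::
    "'a topology \<Rightarrow> 'g set \<Rightarrow> ('g \<Rightarrow> 'a \<Rightarrow> 'a) \<Rightarrow> bool" where
  "convergence_property X \<Gamma> \<rho> \<longleftrightarrow>
     (\<forall>\<gamma> :: nat \<Rightarrow> 'g. inj \<gamma> \<and> range \<gamma> \<subseteq> \<Gamma> \<longrightarrow>
        (\<exists>x\<in>topspace X. \<exists>y\<in>topspace X. \<exists>r :: nat \<Rightarrow> nat. strict_mono r \<and>
           loc_unif_to_const X (topspace X - {y}) (\<lambda>j. \<rho> (\<gamma> (r j))) x))"

definition convergence_group :: "('m::topological_space \<Rightarrow> 'm) set \<Rightarrow> bool" where
  "convergence_group \<Gamma> \<longleftrightarrow>
     subgroup \<Gamma> homeo_group \<and> convergence_property euclidean \<Gamma> (\<lambda>\<gamma>. \<gamma>)"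

definition limit_set :: "('m::topological_space \<Rightarrow> 'm) set \<Rightarrow> 'm set" where
  "limit_set \<Gamma> =
     {x. \<exists>y. \<exists>\<gamma> :: nat \<Rightarrow> 'm \<Rightarrow> 'm. range \<gamma> \<subseteq> \<Gamma> \<and> loc_unif_to_const euclidean (UNIV - {y}) \<gamma> x}"

definition non_elementary :: "('m::topological_space \<Rightarrow> 'm) set \<Rightarrow> bool" where
  "non_elementary \<Gamma> \<longleftrightarrow> infinite (limit_set \<Gamma>) \<or> card (limit_set \<Gamma>) \<ge> 3"

text \<open>
  \<open>loxodromic_with \<Gamma> \<gamma> p q\<close>: the element \<open>\<gamma>\<close> is loxodromic with attracting point
  \<open>p\<close> (i.e. \<open>\<gamma>\<close>-plus) and repelling point \<open>q\<close> (i.e. \<open>\<gamma>\<close>-minus).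
\<close>

definition loxodromic_with ::
    "('m::topological_space \<Rightarrow> 'm) set \<Rightarrow> ('m \<Rightarrow> 'm) \<Rightarrow> 'm \<Rightarrow> 'm \<Rightarrow> bool" where
  "loxodromic_with \<Gamma> \<gamma> p q \<longleftrightarrow>
     \<gamma> \<in> \<Gamma> \<and> p \<in> limit_set \<Gamma> \<and> q \<in> limit_set \<Gamma> \<and> p \<noteq> q \<and> \<gamma> p = p \<and> \<gamma> q = q \<and>
     loc_unif_to_const euclidean (UNIV - {q}) (\<lambda>n. \<gamma> ^^ n) p \<and>
     loc_unif_to_const euclidean (UNIV - {p}) (\<lambda>n. (inv\<^bsub>homeo_group\<^esub> \<gamma>) ^^ n) q"


section \<open>Compatible metrics\<close>

text \<open>
  The disjoint union of \<open>\<Gamma>\<close> and the space is \<open>\<Gamma> <+> UNIV\<close>, a subset of a sum type, with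
  \<open>Inl\<close> and \<open>Inr\<close> the two inclusions.
\<close>

fun natural_action :: "('m \<Rightarrow> 'm) \<Rightarrow> ('m \<Rightarrow> 'm) + 'm \<Rightarrow> ('m \<Rightarrow> 'm) + 'm" where
  "natural_action \<gamma> (Inl \<alpha>) = Inl (\<gamma> \<circ> \<alpha>)"
| "natural_action \<gamma> (Inr x) = Inr (\<gamma> x)"

definition compactifying_topology ::
    "('m::topological_space \<Rightarrow> 'm) set \<Rightarrow> (('m \<Rightarrow> 'm) + 'm) topology \<Rightarrow> bool" where
  "compactifying_topology \<Gamma> X \<longleftrightarrow>
     topspace X = \<Gamma> <+> UNIV \<and> compact_space X \<and> metrizable_space X \<and>
     embedding_map (discrete_topology \<Gamma>) X Inl \<and>
     embedding_map euclidean X Inr \<and>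
     (\<forall>\<gamma>\<in>\<Gamma>. homeomorphic_map X X (natural_action \<gamma>)) \<and>
     convergence_property X \<Gamma> natural_action"

definition compatible_metric ::
    "('m::topological_space \<Rightarrow> 'm) set \<Rightarrow> (('m \<Rightarrow> 'm) + 'm \<Rightarrow> ('m \<Rightarrow> 'm) + 'm \<Rightarrow> real) \<Rightarrow> bool"
  where
  "compatible_metric \<Gamma> d \<longleftrightarrow>
     Metric_space (\<Gamma> <+> UNIV) d \<and>
     compactifying_topology \<Gamma> (Metric_space.mtopology (\<Gamma> <+> UNIV) d)"


section \<open>Coarse-cocycles\<close>

text \<open>Only the values of \<open>\<sigma>\<close> on \<open>\<Gamma>\<close> are constrained.\<close>

definition kappa_coarse_cocycle ::
    "('m::topological_space \<Rightarrow> 'm) set \<Rightarrow> real \<Rightarrow> (('m \<Rightarrow> 'm) \<Rightarrow> 'm \<Rightarrow> real) \<Rightarrow> bool" where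
  "kappa_coarse_cocycle \<Gamma> \<kappa> \<sigma> \<longleftrightarrow>
     (\<forall>\<gamma>\<in>\<Gamma>. \<forall>x0. Limsup (at x0) (\<lambda>x. ereal \<bar>\<sigma> \<gamma> x0 - \<sigma> \<gamma> x\<bar>) \<le> ereal \<kappa>) \<and>
     (\<forall>\<gamma>1\<in>\<Gamma>. \<forall>\<gamma>2\<in>\<Gamma>. \<forall>x. \<bar>\<sigma> (\<gamma>1 \<circ> \<gamma>2) x - (\<sigma> \<gamma>1 (\<gamma>2 x) + \<sigma> \<gamma>2 x)\<bar> \<le> \<kappa>)"

definition coarse_cocycle ::
    "('m::topological_space \<Rightarrow> 'm) set \<Rightarrow> (('m \<Rightarrow> 'm) \<Rightarrow> 'm \<Rightarrow> real) \<Rightarrow> bool" where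
  "coarse_cocycle \<Gamma> \<sigma> \<longleftrightarrow> (\<exists>\<kappa>\<ge>0. kappa_coarse_cocycle \<Gamma> \<kappa> \<sigma>)"

definition proper_cocycle ::
    "('m::topological_space \<Rightarrow> 'm) set \<Rightarrow> (('m \<Rightarrow> 'm) + 'm \<Rightarrow> ('m \<Rightarrow> 'm) + 'm \<Rightarrow> real)
      \<Rightarrow> (('m \<Rightarrow> 'm) \<Rightarrow> 'm \<Rightarrow> real) \<Rightarrow> bool" where
  "proper_cocycle \<Gamma> d \<sigma> \<longleftrightarrow>
     (\<forall>(\<gamma> :: nat \<Rightarrow> 'm \<Rightarrow> 'm) p q.
        inj \<gamma> \<and> (\<forall>n. loxodromic_with \<Gamma> (\<gamma> n) (p n) (q n)) \<and>
        liminf (\<lambda>n. ereal (d (Inr (q n)) (Inr (p n)))) > 0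
        \<longrightarrow> filterlim (\<lambda>n. \<sigma> (\<gamma> n) (p n)) at_top sequentially)"

definition magnitude_function ::
    "('m::topological_space \<Rightarrow> 'm) set \<Rightarrow> (('m \<Rightarrow> 'm) + 'm \<Rightarrow> ('m \<Rightarrow> 'm) + 'm \<Rightarrow> real)
      \<Rightarrow> (('m \<Rightarrow> 'm) \<Rightarrow> 'm \<Rightarrow> real) \<Rightarrow> (('m \<Rightarrow> 'm) \<Rightarrow> real) \<Rightarrow> bool" where
  "magnitude_function \<Gamma> d \<sigma> mag \<longleftrightarrow>
     (\<forall>\<epsilon>>0. \<exists>C>0. \<forall>x. \<forall>\<gamma>\<in>\<Gamma>. d (Inr x) (Inl (inv\<^bsub>homeo_group\<^esub> \<gamma>)) > \<epsilon> \<longrightarrow>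
        mag \<gamma> - C \<le> \<sigma> \<gamma> x \<and> \<sigma> \<gamma> x \<le> mag \<gamma> + C)"

definition expanding_coarse_cocycle ::
    "('m::topological_space \<Rightarrow> 'm) set \<Rightarrow> (('m \<Rightarrow> 'm) + 'm \<Rightarrow> ('m \<Rightarrow> 'm) + 'm \<Rightarrow> real)
      \<Rightarrow> (('m \<Rightarrow> 'm) \<Rightarrow> 'm \<Rightarrow> real) \<Rightarrow> bool" where
  "expanding_coarse_cocycle \<Gamma> d \<sigma> \<longleftrightarrow>
     coarse_cocycle \<Gamma> \<sigma> \<and> proper_cocycle \<Gamma> d \<sigma> \<and> (\<exists>mag. magnitude_function \<Gamma> d \<sigma> mag)"


section \<open>Critical exponents\<close>

definition poincare_series :: "('g \<Rightarrow> real) \<Rightarrow> 'g set \<Rightarrow> real \<Rightarrow> ennreal" where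
  "poincare_series mag H s = (\<Sum>\<^sub>\<infinity>h\<in>H. ennreal (exp (- s * mag h)))"

text \<open>The infimum is taken in the extended reals, so it is infinite for the empty set.\<close>

definition critical_exponent :: "('g \<Rightarrow> real) \<Rightarrow> 'g set \<Rightarrow> ereal" where
  "critical_exponent mag H = Inf {ereal s |s. s > 0 \<and> poincare_series mag H s < \<infinity>}"

end

theory Submission
  imports Defs
begin

text \<open>
  Pick \<open>x\<close> in the limit set of \<open>\<Gamma>\<close> but not in that of \<open>G\<close>. A small ball \<open>B\<close> around \<open>x\<close> in the
  compactification meets only finitely many of its \<open>G\<close>-translates, and \<open>G\<close> stays away from it. Hence
  \<open>(g, c) \<mapsto> g c\<close> is finite-to-one on \<open>G \<times> (B \<inter> \<Gamma>)\<close>, and the expansion property gives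
  \<open>\<parallel>g c\<parallel> \<le> \<parallel>g\<parallel> + \<parallel>c\<parallel> + C\<close> for all but finitely many \<open>c\<close>, so the Poincare series satisfy \<open>P\<^sub>G(s) P\<^sub>B(s) \<le> N(s) P\<^sub>\<Gamma>(s)\<close>. A
  non-elementary group has no global fixed point, so every orbit accumulates at \<open>x\<close>; by compactness
  finitely many translates of \<open>B\<close> cover \<open>\<Gamma>\<close> up to a finite set, and \<open>P\<^sub>\<Gamma>(s) \<le> F(s) + K(s) P\<^sub>B(s)\<close>.
  Combining the two bounds \<open>P\<^sub>G(s)\<close> for \<open>s > \<delta>(\<Gamma>)\<close> by a continuous function of \<open>s\<close>. If \<open>\<delta>(G) = \<delta>(\<Gamma>)\<close>,
  letting \<open>s\<close> decrease to \<open>\<delta>(G)\<close> contradicts the divergence of the series of \<open>G\<close> there.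
\<close>

section \<open>Locally uniform convergence and convergence groups\<close>

lemma loc_unif_to_const_subseq:
  assumes "loc_unif_to_const X A f x" "strict_mono (r :: nat \<Rightarrow> nat)"
  shows "loc_unif_to_const X A (\<lambda>j. f (r j)) x"
  unfolding loc_unif_to_const_def
proof
  fix p assume "p \<in> A"
  then obtain V where V: "openin X V" "p \<in> V"
      "\<And>U. openin X U \<Longrightarrow> x \<in> U \<Longrightarrow> \<forall>\<^sub>F n in sequentially. f n ` (V \<inter> A) \<subseteq> U"
    using assms unfolding loc_unif_to_const_def by meson
  then show "\<exists>V. openin X V \<and> p \<in> V \<and>
      (\<forall>U. openin X U \<and> x \<in> U \<longrightarrow> (\<forall>\<^sub>F n in sequentially. f (r n) ` (V \<inter> A) \<subseteq> U))"
    using eventually_subseq[OF assms(2)] by blast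
qed

text \<open>A finite subcover turns the local estimates into one on all of \<open>K\<close>: only
  finitely many neighbourhoods matter, so their thresholds can be combined.\<close>

lemma loc_unif_to_const_compactin:
  assumes f: "loc_unif_to_const X A f x" and K: "compactin X K" "K \<subseteq> A"
    and U: "openin X U" "x \<in> U"
  shows "\<forall>\<^sub>F n in sequentially. f n ` K \<subseteq> U"
proof -
  have "\<forall>p\<in>K. \<exists>V. openin X V \<and> p \<in> V \<and> (\<forall>\<^sub>F n in sequentially. f n ` (V \<inter> A) \<subseteq> U)"
    using f K(2) U unfolding loc_unif_to_const_def by (meson subsetD)
  then obtain V where V: "\<And>p. p \<in> K \<Longrightarrow> openin X (V p)" "\<And>p. p \<in> K \<Longrightarrow> p \<in> V p"
      "\<And>p. p \<in> K \<Longrightarrow> \<forall>\<^sub>F n in sequentially. f n ` (V p \<inter> A) \<subseteq> U"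
    by metis
  have "\<exists>\<F>. finite \<F> \<and> \<F> \<subseteq> V ` K \<and> K \<subseteq> \<Union>\<F>"
    using V(1,2) by (intro compactinD[OF K(1)]) auto
  then obtain T where T: "finite T" "T \<subseteq> K" "K \<subseteq> (\<Union>p\<in>T. V p)"
    by (metis finite_subset_image)
  have "\<forall>\<^sub>F n in sequentially. \<forall>p\<in>T. f n ` (V p \<inter> A) \<subseteq> U"
    using T(1,2) V(3) by (auto intro!: eventually_ball_finite)
  then show ?thesis
    by eventually_elim (use T(3) K(2) in blast)
qed

lemma loc_unif_to_const_pointwise:
  assumes "loc_unif_to_const X A f x" "x \<in> topspace X" "p \<in> A"
  shows "limitin X (\<lambda>n. f n p) x sequentially"
  unfolding limitin_def
proof (intro conjI allI impI)
  fix U assume "openin X U \<and> x \<in> U"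
  moreover obtain V where V: "p \<in> V"
      "\<And>U. openin X U \<Longrightarrow> x \<in> U \<Longrightarrow> \<forall>\<^sub>F n in sequentially. f n ` (V \<inter> A) \<subseteq> U"
    using assms(1,3) unfolding loc_unif_to_const_def by meson
  ultimately have "\<forall>\<^sub>F n in sequentially. f n ` (V \<inter> A) \<subseteq> U" by blast
  then show "\<forall>\<^sub>F n in sequentially. f n p \<in> U"
    by eventually_elim (use V(1) assms(3) in blast)
qed (rule assms(2))

lemma convergence_propertyE:
  fixes \<gamma> :: "nat \<Rightarrow> 'g"
  assumes "convergence_property X \<Gamma> \<rho>" "inj \<gamma>" "\<And>n. \<gamma> n \<in> \<Gamma>"
  obtains x y r where "x \<in> topspace X" "y \<in> topspace X" "strict_mono r"
    "loc_unif_to_const X (topspace X - {y}) (\<lambda>j. \<rho> (\<gamma> (r j))) x"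
proof -
  have "inj \<gamma> \<and> range \<gamma> \<subseteq> \<Gamma>" using assms(2,3) by blast
  with assms(1)[unfolded convergence_property_def, rule_format, of \<gamma>] show ?thesis
    using that by blast
qed

text \<open>Replaces the operations of \<open>homeo_group\<close> by \<open>inv_into\<close>,
  composition and \<open>id\<close>, in which all later computations take place.\<close>

lemma convergence_group_elem:
  assumes "convergence_group \<Gamma>"
  shows "\<And>f. f \<in> \<Gamma> \<Longrightarrow> bij f" "\<And>f. f \<in> \<Gamma> \<Longrightarrow> continuous_on UNIV f"
    "\<And>f. f \<in> \<Gamma> \<Longrightarrow> inv\<^bsub>homeo_group\<^esub> f = inv_into UNIV f"
    "\<And>f. f \<in> \<Gamma> \<Longrightarrow> inv_into UNIV f \<in> \<Gamma>"
    "\<And>f g. f \<in> \<Gamma> \<Longrightarrow> g \<in> \<Gamma> \<Longrightarrow> f \<circ> g \<in> \<Gamma>" "id \<in> \<Gamma>"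
proof -
  have s: "subgroup \<Gamma> homeo_group" using assms by (simp add: convergence_group_def)
  have c: "f \<in> carrier homeo_group" if "f \<in> \<Gamma>" for f using subgroup.mem_carrier[OF s that] .
  show "\<And>f. f \<in> \<Gamma> \<Longrightarrow> bij f" "\<And>f. f \<in> \<Gamma> \<Longrightarrow> continuous_on UNIV f"
    using c by (auto simp: homeo_group_def homeomorphic_eq_everything_map bij_def)
  show i: "\<And>f. f \<in> \<Gamma> \<Longrightarrow> inv\<^bsub>homeo_group\<^esub> f = inv_into UNIV f"
    using c inv_homeo_group by blast
  show "\<And>f. f \<in> \<Gamma> \<Longrightarrow> inv_into UNIV f \<in> \<Gamma>"
    using subgroup.m_inv_closed[OF s] i by metis
  show "\<And>f g. f \<in> \<Gamma> \<Longrightarrow> g \<in> \<Gamma> \<Longrightarrow> f \<circ> g \<in> \<Gamma>"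
    using subgroup.m_closed[OF s] by (simp add: homeo_group_def)
  show "id \<in> \<Gamma>" using subgroup.one_closed[OF s] by (simp add: homeo_group_def)
qed

lemma convergence_group_subseq:
  fixes \<gamma> :: "nat \<Rightarrow> 'm::topological_space \<Rightarrow> 'm"
  assumes "convergence_group \<Gamma>" "inj \<gamma>" "\<And>n. \<gamma> n \<in> \<Gamma>"
  obtains r y x where "strict_mono r" "loc_unif_to_const euclidean (UNIV - {y}) (\<lambda>j. \<gamma> (r j)) x"
proof -
  have "convergence_property euclidean \<Gamma> (\<lambda>f. f)"
    using assms(1) by (simp add: convergence_group_def)
  from convergence_propertyE[OF this assms(2,3)] show ?thesis
    using that by (metis topspace_euclidean)
qed

section \<open>Non-elementary groups have no global fixed point\<close>

lemma convergence_group_power_closed: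
  assumes "convergence_group \<Gamma>" "f \<in> \<Gamma>"
  shows "f ^^ n \<in> \<Gamma>"
  by (induction n) (use convergence_group_elem(5,6)[OF assms(1)] assms(2) in \<open>auto simp: id_def comp_def\<close>)

text \<open>
  Let \<open>a\<close> and \<open>b\<close> be the fixed points of \<open>g\<close> and \<open>k\<close> in \<open>V\<close>. The elements \<open>g\<^sup>e k g\<^sup>-\<^sup>n\<close>, where \<open>e\<close> is the
  least exponent that brings \<open>k g\<^sup>-\<^sup>n b\<close> back into \<open>V\<close>, are distinct, but they keep the images of the
  triple \<open>y, a, b\<close> in pairwise disjoint closed sets, which contradicts the convergence property.
\<close>

lemma no_ping_pong_at_fixed_point:
  fixes \<Gamma> :: "('m::metric_space \<Rightarrow> 'm) set"
  assumes comp: "compact (UNIV :: 'm set)" and cg: "convergence_group \<Gamma>"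
    and fixy: "\<And>f. f \<in> \<Gamma> \<Longrightarrow> f y = y"
    and V: "closed V" "V \<noteq> {}" "y \<notin> V" and W: "open W" "W \<subseteq> V"
    and g: "g \<in> \<Gamma>" "g ` V \<subseteq> W" and k: "k \<in> \<Gamma>" "k ` V \<subseteq> W" and disj: "g ` V \<inter> k ` V = {}"
  shows False
proof -
  note el = convergence_group_elem[OF cg]
  have injf: "f a = f b \<longleftrightarrow> a = b" if "f \<in> \<Gamma>" for f a b
    using el(1)[OF that] by (meson bij_is_inj inj_eq)
  have finv: "f (inv_into UNIV f a) = a" "inv_into UNIV f (f a) = a" if "f \<in> \<Gamma>" for f a
    using el(1)[OF that] by (simp_all add: bij_is_surj surj_f_inv_f bij_is_inj)
  have pw: "f ^^ n \<in> \<Gamma>" if "f \<in> \<Gamma>" for f n using convergence_group_power_closed[OF cg that] .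
  have inV: "(f ^^ n) v \<in> V" if "f ` V \<subseteq> W" "v \<in> V" for f n v
    using that W by (induction n) auto
  have ingV: "(f ^^ n) v \<in> f ` V" if "f ` V \<subseteq> W" "v \<in> V" "n > 0" for f n v
    using inV[OF that(1,2), of "n - 1"] that(3) by (cases n) auto
  \<comment> \<open>If two powers agreed, some positive power would be the identity, and
    \<open>V\<close> would be contained in its own image under \<open>f\<close>.\<close>
  have injpw: "inj (\<lambda>n. f ^^ n)" if f: "f \<in> \<Gamma>" "f ` V \<subseteq> W" "f ` V \<noteq> V" for f
  proof (rule injI, rule ccontr)
    fix m n assume eq: "f ^^ m = f ^^ n" "m \<noteq> n"
    have *: False if "f ^^ m = f ^^ n" "m < n" for m n
    proof -
      have "(f ^^ (n - m)) v = v" for v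
      proof -
        have "(f ^^ m) ((f ^^ (n - m)) v) = (f ^^ m) v"
          using that by (metis add_diff_inverse_nat comp_apply funpow_add less_imp_not_less)
        then show ?thesis using injf[OF pw[OF f(1)]] by blast
      qed
      then have "V \<subseteq> f ` V" using ingV[OF f(2), of _ "n - m"] that(2) by fastforce
      then show False using f(2,3) W(2) by blast
    qed
    show False using * eq by (metis nat_neq_iff)
  qed
  \<comment> \<open>A subsequence of the powers converges to some \<open>a\<close> away from some
    \<open>b\<close>. Since \<open>V\<close> has two points, one of them differs from
    \<open>b\<close>, and its orbit keeps \<open>a\<close> in \<open>V\<close>. The fixed point
    \<open>y\<close> cannot converge to \<open>a\<close>, so it is \<open>b\<close>. Finally
    \<open>f\<close> commutes with its powers, which makes \<open>a\<close> a fixed point.\<close>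
  have attr: "\<exists>a\<in>V. f a = a \<and> (\<forall>K U. closed K \<and> y \<notin> K \<and> open U \<and> a \<in> U \<longrightarrow> (\<exists>n. (f ^^ n) ` K \<subseteq> U))"
    if f: "f \<in> \<Gamma>" "f ` V \<subseteq> W" "f ` V \<noteq> V" for f
  proof -
    obtain a b r where r: "strict_mono r"
      and l: "loc_unif_to_const euclidean (UNIV - {b}) (\<lambda>j. f ^^ r j) a"
      by (rule convergence_group_subseq[OF cg injpw[OF f] pw[OF f(1)]]) (rule that)
    have lp: "(\<lambda>j. (f ^^ r j) p) \<longlonglongrightarrow> a" if "p \<noteq> b" for p
      using loc_unif_to_const_pointwise[OF l, of p] that by simp
    have fixp: "(f ^^ n) y = y" for n using fixy[OF pw[OF f(1)]] .
    obtain v where v: "v \<in> V" using V by auto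
    have "V \<noteq> {v}"
    proof
      assume "V = {v}"
      moreover have "f v \<in> V" using f(2) W(2) v by blast
      ultimately show False using f(3) by simp
    qed
    then obtain v' where v': "v' \<in> V" "v' \<noteq> v" using v by blast
    obtain w where w: "w \<in> V" "w \<noteq> b" using v v' by metis
    have "a \<in> V"
      by (rule Lim_in_closed_set[OF V(1) _ _ lp[OF w(2)]]) (use inV[OF f(2) w(1)] in auto)
    then have "a \<noteq> y" using V by blast
    have "b = y"
    proof (rule ccontr)
      assume "b \<noteq> y"
      from lp[OF this[symmetric]] have "(\<lambda>j. y) \<longlonglongrightarrow> a" by (simp add: fixp)
      then show False using \<open>a \<noteq> y\<close> by (simp add: LIMSEQ_const_iff)
    qed
    have "f w \<noteq> y" using f(2) w W V by blast
    have "(\<lambda>j. f ((f ^^ r j) w)) \<longlonglongrightarrow> f a"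
      using continuous_on_tendsto_compose[OF el(2)[OF f(1)] lp[OF w(2)]] by simp
    moreover have "(\<lambda>j. f ((f ^^ r j) w)) \<longlonglongrightarrow> a"
      using lp[of "f w"] \<open>f w \<noteq> y\<close> \<open>b = y\<close> by (simp add: funpow_swap1)
    ultimately have "f a = a" using LIMSEQ_unique by blast
    moreover have "\<exists>n. (f ^^ n) ` K \<subseteq> U" if "closed K" "y \<notin> K" "open U" "a \<in> U" for K U
    proof -
      have "compact K" using comp that(1) compact_Int_closed[of UNIV K] by simp
      then have "\<forall>\<^sub>F j in sequentially. (f ^^ r j) ` K \<subseteq> U"
        using that \<open>b = y\<close> by (intro loc_unif_to_const_compactin[OF l]) auto
      then show ?thesis using eventually_happens'[OF sequentially_bot] by blast
    qed
    ultimately show ?thesis using \<open>a \<in> V\<close> by blast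
  qed
  have ne: "g ` V \<noteq> V" "k ` V \<noteq> V" using g k W disj V by blast+
  from attr[OF g ne(1)] obtain a where a: "a \<in> V" "g a = a"
      "\<forall>K U. closed K \<and> y \<notin> K \<and> open U \<and> a \<in> U \<longrightarrow> (\<exists>n. (g ^^ n) ` K \<subseteq> U)"
    by (elim bexE conjE) (rule that)
  obtain b where b: "b \<in> V" "k b = b" using attr[OF k ne(2)] by blast
  have bg: "b \<notin> g ` V" using b disj by (metis disjoint_iff imageI)
  have "a \<in> W" using a g by (metis image_subset_iff)
  have ga: "(g ^^ n) a = a" for n by (induction n) (auto simp: a)
  have opg: "open (f ` U)" if "f \<in> \<Gamma>" "open U" for f U
  proof -
    have "f ` U = inv_into UNIV f -` U"
      using bij_vimage_eq_inv_image[OF el(1)[OF el(4)[OF that(1)]]] inv_inv_eq[OF el(1)[OF that(1)]]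
      by simp
    then show ?thesis using open_vimage[OF that(2) el(2)[OF el(4)[OF that(1)]]] by simp
  qed
  have clg: "closed (f ` U)" if "f \<in> \<Gamma>" "closed U" for f U
  proof -
    have "- (f ` U) = f ` (- U)" using bij_image_Compl_eq[OF el(1)[OF that(1)]] by simp
    then show ?thesis using opg[OF that(1), of "- U"] that(2) by (simp add: closed_def)
  qed
  \<comment> \<open>Removing the open image of \<open>W\<close>, instead of the image of
    \<open>V\<close>, keeps \<open>D\<close> closed. It still misses the second image of
    \<open>V\<close> under \<open>g\<close>, because \<open>g\<close> sends \<open>V\<close> into
    \<open>W\<close>.\<close>
  define D where "D = V - g ` W"
  have D: "closed D" unfolding D_def using V(1) opg[OF g(1) W(1)] by blast
  \<comment> \<open>Take the first entry time of the orbit into \<open>V\<close>. The times 0 and 1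
    are excluded because \<open>g z\<close> is outside \<open>V\<close>. The point just before entry
    is outside \<open>V\<close>, so by injectivity the entry point is not in the image of
    \<open>V\<close>.\<close>
  have entry: "\<exists>N\<ge>2. (g ^^ N) z \<in> V - g ` V" if z: "z \<noteq> y" "g z \<notin> V" for z
  proof -
    have "\<exists>n. (g ^^ n) ` {z} \<subseteq> W" using z \<open>a \<in> W\<close> W by (intro a(3)[rule_format]) auto
    then have ex: "\<exists>n. (g ^^ n) z \<in> V" using W by auto
    define N where "N = (LEAST n. (g ^^ n) z \<in> V)"
    have N: "(g ^^ N) z \<in> V" unfolding N_def by (rule LeastI_ex[OF ex])
    have N2: "(g ^^ n) z \<notin> V" if "n < N" for n
      using not_less_Least[of n "\<lambda>n. (g ^^ n) z \<in> V"] that unfolding N_def by blast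
    have "N \<noteq> 0"
    proof
      assume "N = 0"
      then have "z \<in> V" using N by simp
      then show False using z(2) g(2) W(2) by blast
    qed
    moreover have "N \<noteq> 1"
    proof
      assume "N = 1"
      then show False using N z(2) by simp
    qed
    ultimately have "N \<ge> 2" by simp
    then have "(g ^^ (N - 1)) z \<notin> V" using N2 by simp
    moreover have "(g ^^ N) z = g ((g ^^ (N - 1)) z)"
      using \<open>N \<noteq> 0\<close> by (cases N) simp_all
    ultimately have "(g ^^ N) z \<notin> g ` V" using injf[OF g(1)] by (metis imageE)
    then show ?thesis using N \<open>N \<ge> 2\<close> by blast
  qed
  \<comment> \<open>\<open>K\<close> consists of the points that \<open>g \<circ> k\<close> sends
    into \<open>V\<close>. Some power \<open>g ^^ n0\<close> brings all of \<open>K\<close> into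
    \<open>W\<close>; if a further backward iterate of \<open>b\<close> were in \<open>K\<close>,
    then \<open>b\<close> would lie in the image of \<open>V\<close> under \<open>g\<close>.\<close>
  define K where "K = inv_into UNIV k ` inv_into UNIV g ` V"
  have "closed K" unfolding K_def using clg el(4) g(1) k(1) V(1) by blast
  moreover have "y \<notin> K"
    unfolding K_def using V fixy[OF el(4)[OF k(1)]] fixy[OF el(4)[OF g(1)]] injf[OF el(4)[OF k(1)]] injf[OF el(4)[OF g(1)]]
    by (metis (no_types, opaque_lifting) imageE)
  ultimately obtain n0 where n0: "(g ^^ n0) ` K \<subseteq> W" using a(3)[rule_format, of K W] \<open>a \<in> W\<close> W(1) by blast
  define z where "z n = k (inv_into UNIV (g ^^ n) b)" for n
  have z: "z n \<noteq> y" "g (z n) \<notin> V" if "n > n0" for n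
  proof -
    have "inv_into UNIV (g ^^ n) b \<noteq> y"
      using finv(1)[OF pw[OF g(1)], of n b] fixy[OF pw[OF g(1)], of n] b V by metis
    then show "z n \<noteq> y" unfolding z_def using fixy[OF k(1)] injf[OF k(1)] by metis
    show "g (z n) \<notin> V"
    proof
      assume "g (z n) \<in> V"
      then have "inv_into UNIV (g ^^ n) b \<in> K"
        unfolding K_def z_def by (metis finv(2) g(1) imageI k(1))
      then have "(g ^^ n0) (inv_into UNIV (g ^^ n) b) \<in> V" using n0 W by blast
      then have "(g ^^ (n - n0)) ((g ^^ n0) (inv_into UNIV (g ^^ n) b)) \<in> g ` V"
        using ingV[OF g(2)] that by simp
      moreover have "(g ^^ (n - n0)) ((g ^^ n0) (inv_into UNIV (g ^^ n) b)) = b"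
        using finv(1)[OF pw[OF g(1)], of n b] that
        by (metis comp_apply funpow_add le_add_diff_inverse2 less_imp_le)
      ultimately show False using bg by simp
    qed
  qed
  have "\<forall>n. \<exists>N. n > n0 \<longrightarrow> N \<ge> 2 \<and> (g ^^ N) (z n) \<in> V - g ` V"
    using entry z by blast
  then obtain e where e: "\<And>n. n > n0 \<Longrightarrow> e n \<ge> 2" "\<And>n. n > n0 \<Longrightarrow> (g ^^ e n) (z n) \<in> V - g ` V"
    by metis
  \<comment> \<open>The shift by \<open>Suc n0\<close> keeps every index in the range where
    \<open>e\<close> is controlled.\<close>
  define h where "h n = g ^^ e (n + Suc n0) \<circ> (k \<circ> inv_into UNIV (g ^^ (n + Suc n0)))" for n
  have h\<Gamma>: "h n \<in> \<Gamma>" for n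
    unfolding h_def using g(1) k(1) pw el(4,5) by metis
  have hinv: "inv_into UNIV (g ^^ n) a = a" for n
    using finv(2)[OF pw[OF g(1)], of n a] ga[of n] by simp
  have ha: "h n a = (g ^^ e (n + Suc n0)) (k a)" for n unfolding h_def comp_apply hinv by (rule refl)
  have ka: "k a \<in> V" "k a \<notin> g ` V" using a(1) k(2) W(2) disj by blast+
  have "inj h"
  proof (rule injI)
    fix m n assume eq: "h m = h n"
    \<comment> \<open>The point \<open>k a\<close> lies outside the image of \<open>V\<close> under
      \<open>g\<close>, but every positive power of \<open>g\<close> moves it inside, so the
      exponent can be read off from the image of \<open>k a\<close>.\<close>
    have *: False if "(g ^^ p) (k a) = (g ^^ q) (k a)" "p < q" for p q
    proof -
      have "(g ^^ p) ((g ^^ (q - p)) (k a)) = (g ^^ p) (k a)"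
        using that by (metis add_diff_inverse_nat comp_apply funpow_add less_imp_not_less)
      then have "(g ^^ (q - p)) (k a) = k a" using injf[OF pw[OF g(1)]] by blast
      then show False using ingV[OF g(2) ka(1), of "q - p"] that(2) ka(2) by simp
    qed
    have "(g ^^ e (m + Suc n0)) (k a) = (g ^^ e (n + Suc n0)) (k a)"
      using eq ha by metis
    then have ee: "e (m + Suc n0) = e (n + Suc n0)" using * by (metis nat_neq_iff)
    have "inv_into UNIV (g ^^ (m + Suc n0)) x = inv_into UNIV (g ^^ (n + Suc n0)) x" for x
      using fun_cong[OF eq, of x]
      unfolding h_def comp_apply ee injf[OF pw[OF g(1)]] injf[OF k(1)] .
    then have "g ^^ (m + Suc n0) = g ^^ (n + Suc n0)"
      by (metis el(1) ext g(1) inv_inv_eq pw)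
    then show "m = n" using injpw[OF g ne(1)] by (metis add_right_cancel injD)
  qed
  then obtain x w r where r: "strict_mono r"
    and l: "loc_unif_to_const euclidean (UNIV - {w}) (\<lambda>j. h (r j)) x"
    by (rule convergence_group_subseq[OF cg _ h\<Gamma>]) (rule that)
  have lp: "(\<lambda>j. h (r j) p) \<longlonglongrightarrow> x" if "p \<noteq> w" for p
    using loc_unif_to_const_pointwise[OF l, of p] that by simp
  \<comment> \<open>Since \<open>a\<close> is fixed by \<open>g\<close>, the point
    \<open>h n a\<close> is a power of \<open>g\<close> applied to \<open>k a\<close>. The exponent
    being at least 2 places it in the second image of \<open>V\<close>, which is disjoint from
    \<open>D\<close>.\<close>
  have xa: "x \<in> g ` g ` V" if "a \<noteq> w"
  proof (rule Lim_in_closed_set[OF _ _ _ lp[OF that]])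
    show "closed (g ` g ` V)" using clg g(1) V(1) by blast
    have "h n a \<in> g ` g ` V" for n
    proof -
      have E: "e (n + Suc n0) \<ge> 2" using e(1)[of "n + Suc n0"] by simp
      then have "(g ^^ (e (n + Suc n0) - 1)) (k a) \<in> g ` V" using ingV[OF g(2) ka(1)] by simp
      moreover have "h n a = g ((g ^^ (e (n + Suc n0) - 1)) (k a))"
        unfolding ha using E by (cases "e (n + Suc n0)") auto
      ultimately show ?thesis by simp
    qed
    then show "\<forall>\<^sub>F j in sequentially. h (r j) a \<in> g ` g ` V" by simp
  qed simp
  have xb: "x \<in> D" if "b \<noteq> w"
  proof (rule Lim_in_closed_set[OF D _ _ lp[OF that]])
    have "h n b \<in> D" for n
      unfolding D_def h_def using e(2)[of "n + Suc n0"] W(2) by (auto simp: z_def)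
    then show "\<forall>\<^sub>F j in sequentially. h (r j) b \<in> D" by simp
  qed simp
  have xy: "x = y" if "y \<noteq> w"
    using lp[OF that] fixy[OF h\<Gamma>] by (simp add: LIMSEQ_const_iff)
  have dis: "g ` g ` V \<subseteq> V - D" "y \<notin> V"
    unfolding D_def using g(2) W(2) V(3) by blast+
  \<comment> \<open>At most one of the distinct points \<open>a\<close>, \<open>b\<close>,
    \<open>y\<close> can be the exceptional point \<open>w\<close>, so \<open>x\<close> would lie in
    two disjoint sets.\<close>
  have "a \<noteq> b" using bg ingV[OF g(2) a(1), of 1] a(2) by auto
  moreover have "a \<noteq> y" "b \<noteq> y" using a b V by auto
  moreover have "D \<subseteq> V" unfolding D_def by blast
  ultimately show False using xa xb xy dis by blast
qed

text \<open>Were \<open>y\<close> fixed by the whole group, two limit points other than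
  \<open>y\<close> would each supply an element contracting the complement of a ball around
  \<open>y\<close> into a small ball around that limit point. This is the configuration just
  excluded.\<close>

lemma non_elementary_no_global_fixed_point:
  fixes \<Gamma> :: "('m::metric_space \<Rightarrow> 'm) set"
  assumes comp: "compact (UNIV :: 'm set)" and cg: "convergence_group \<Gamma>"
    and ne: "non_elementary \<Gamma>"
  shows "\<exists>f\<in>\<Gamma>. f y \<noteq> y"
proof (rule ccontr)
  assume "\<not> (\<exists>f\<in>\<Gamma>. f y \<noteq> y)"
  then have fixy: "f y = y" if "f \<in> \<Gamma>" for f using that by blast
  have "\<exists>\<xi>\<in>limit_set \<Gamma>. \<exists>\<zeta>\<in>limit_set \<Gamma>. \<xi> \<noteq> y \<and> \<zeta> \<noteq> y \<and> \<xi> \<noteq> \<zeta>"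
  proof (rule ccontr)
    assume *: "\<not> ?thesis"
    obtain c where "limit_set \<Gamma> \<subseteq> {y, c}" using * by blast
    then have "finite (limit_set \<Gamma>)" "card (limit_set \<Gamma>) \<le> card {y, c}"
      by (auto intro: card_mono finite_subset)
    moreover have "card {y, c} \<le> 2" by (simp add: card_insert_if)
    ultimately show False using ne unfolding non_elementary_def by linarith
  qed
  then obtain \<xi> \<zeta> where x: "\<xi> \<in> limit_set \<Gamma>" "\<zeta> \<in> limit_set \<Gamma>" "\<xi> \<noteq> y" "\<zeta> \<noteq> y" "\<xi> \<noteq> \<zeta>" by blast
  \<comment> \<open>Half the smallest distance makes the balls of radius \<open>r\<close> around the
    three points pairwise disjoint.\<close>
  define r where "r = Min {dist \<xi> y, dist \<zeta> y, dist \<xi> \<zeta>} / 2"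
  have r: "r > 0" "2 * r \<le> dist \<xi> y" "2 * r \<le> dist \<zeta> y" "2 * r \<le> dist \<xi> \<zeta>"
    using x by (auto simp: r_def)
  have contr: "\<exists>f\<in>\<Gamma>. f ` (- ball y r) \<subseteq> ball p r" if p: "p \<in> limit_set \<Gamma>" "p \<noteq> y" for p
  proof -
    obtain q \<gamma> where \<gamma>: "range \<gamma> \<subseteq> \<Gamma>" "loc_unif_to_const euclidean (UNIV - {q}) \<gamma> p"
      using p(1) unfolding limit_set_def by blast
    \<comment> \<open>The images of \<open>y\<close> are constant and cannot tend to
      \<open>p\<close>, so \<open>y\<close> must be the exceptional point of the sequence.\<close>
    have "q = y"
    proof (rule ccontr)
      assume "q \<noteq> y"
      then have "(\<lambda>n. \<gamma> n y) \<longlonglongrightarrow> p"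
        using loc_unif_to_const_pointwise[OF \<gamma>(2), of y] by simp
      moreover have "\<gamma> n y = y" for n using fixy \<gamma>(1) by blast
      ultimately show False using that(2) by (simp add: LIMSEQ_const_iff)
    qed
    have "compact (- ball y r)"
      using compact_Int_closed[OF comp, of "- ball y r"] by (simp add: closed_Compl)
    moreover have "- ball y r \<subseteq> UNIV - {q}" using r(1) \<open>q = y\<close> by auto
    ultimately have "\<forall>\<^sub>F n in sequentially. \<gamma> n ` (- ball y r) \<subseteq> ball p r"
      using r(1) loc_unif_to_const_compactin[OF \<gamma>(2), of "- ball y r" "ball p r"] by simp
    then obtain n where "\<gamma> n ` (- ball y r) \<subseteq> ball p r"
      using eventually_happens'[OF sequentially_bot] by blast
    then show ?thesis using \<gamma>(1) by blast
  qed
  obtain g where g: "g \<in> \<Gamma>" "g ` (- ball y r) \<subseteq> ball \<xi> r" using contr x by blast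
  obtain k where k: "k \<in> \<Gamma>" "k ` (- ball y r) \<subseteq> ball \<zeta> r" using contr x by blast
  have sub: "ball \<xi> r \<subseteq> - ball y r" "ball \<zeta> r \<subseteq> - ball y r"
  proof -
    show "ball \<xi> r \<subseteq> - ball y r"
    proof
      fix u assume "u \<in> ball \<xi> r"
      then have "dist \<xi> u < r" by simp
      then have "dist y u > r" using r(2) dist_triangle[of \<xi> y u] by (simp add: dist_commute)
      then show "u \<in> - ball y r" by simp
    qed
    show "ball \<zeta> r \<subseteq> - ball y r"
    proof
      fix u assume "u \<in> ball \<zeta> r"
      then have "dist \<zeta> u < r" by simp
      then have "dist y u > r" using r(3) dist_triangle[of \<zeta> y u] by (simp add: dist_commute)
      then show "u \<in> - ball y r" by simp
    qed
  qed
  have "ball \<xi> r \<inter> ball \<zeta> r = {}"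
  proof -
    have False if "dist \<xi> u < r" "dist \<zeta> u < r" for u
      using that r(4) dist_triangle[of \<xi> \<zeta> u] by (simp add: dist_commute)
    then show ?thesis by (metis disjoint_iff mem_ball)
  qed
  then have "g ` (- ball y r) \<inter> k ` (- ball y r) = {}" using g k by blast
  moreover have "\<xi> \<in> - ball y r" using sub(1) r(1) centre_in_ball by blast
  then have "- ball y r \<noteq> {}" by blast
  moreover have "y \<notin> - ball y r" using r(1) by simp
  moreover have "g ` (- ball y r) \<subseteq> ball \<xi> r \<union> ball \<zeta> r" "k ` (- ball y r) \<subseteq> ball \<xi> r \<union> ball \<zeta> r"
    "ball \<xi> r \<union> ball \<zeta> r \<subseteq> - ball y r"
    using g(2) k(2) sub by blast+
  moreover have "closed (- ball y r)" "open (ball \<xi> r \<union> ball \<zeta> r)" by auto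
  ultimately show False
    using no_ping_pong_at_fixed_point[where \<Gamma> = \<Gamma> and y = y and V = "- ball y r"
        and W = "ball \<xi> r \<union> ball \<zeta> r" and g = g and k = k] comp cg fixy g(1) k(1) by meson
qed

text \<open>Locally uniform convergence, unlike pointwise convergence, allows evaluation at a moving
  point, as long as that point converges to a place where the convergence holds.\<close>

lemma loc_unif_to_const_along:
  assumes f: "loc_unif_to_const X A f a" and A: "openin X A" "p \<in> A" and a: "a \<in> topspace X"
    and lim: "limitin X q p sequentially"
  shows "limitin X (\<lambda>n. f n (q n)) a sequentially"
  unfolding limitin_def
proof (intro conjI allI impI)
  fix U assume U: "openin X U \<and> a \<in> U"
  obtain V where V: "openin X V" "p \<in> V"
      "\<And>U. openin X U \<Longrightarrow> a \<in> U \<Longrightarrow> \<forall>\<^sub>F n in sequentially. f n ` (V \<inter> A) \<subseteq> U"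
    using f A(2) unfolding loc_unif_to_const_def by meson
  have "\<forall>\<^sub>F n in sequentially. f n ` (V \<inter> A) \<subseteq> U" using V(3) U by blast
  moreover have "\<forall>\<^sub>F n in sequentially. q n \<in> V \<inter> A"
    using limitinD[OF lim, of "V \<inter> A"] V(1,2) A by (simp add: openin_Int)
  ultimately show "\<forall>\<^sub>F n in sequentially. f n (q n) \<in> U"
    by eventually_elim blast
qed (rule a)

section \<open>Dynamics on the compactification\<close>

locale compactified_group =
  fixes \<Gamma> :: "('m::metric_space \<Rightarrow> 'm) set" and d :: "('m \<Rightarrow> 'm) + 'm \<Rightarrow> ('m \<Rightarrow> 'm) + 'm \<Rightarrow> real"
  assumes compact_UNIV: "compact (UNIV :: 'm set)"
    and convergence_group: "convergence_group \<Gamma>"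
    and non_elementary: "non_elementary \<Gamma>"
    and compatible_metric: "compatible_metric \<Gamma> d"
begin

sublocale Metric_space "\<Gamma> <+> UNIV" d
  using compatible_metric by (simp add: compatible_metric_def)

lemmas elem = convergence_group_elem[OF convergence_group]

lemma compactifying: "compactifying_topology \<Gamma> mtopology"
  using compatible_metric by (simp add: compatible_metric_def)

lemma points_simps [simp]:
  "Inl g \<in> \<Gamma> <+> UNIV \<longleftrightarrow> g \<in> \<Gamma>" "Inr x \<in> \<Gamma> <+> UNIV"
  by auto

lemma inv_simps:
  assumes "g \<in> \<Gamma>"
  shows "g \<circ> inv_into UNIV g = id" "inv_into UNIV g \<circ> g = id" "inv_into UNIV (inv_into UNIV g) = g"
    "g (inv_into UNIV g x) = x" "inv_into UNIV g (g x) = x"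
proof -
  have b: "bij g" using elem(1)[OF assms] .
  show "g \<circ> inv_into UNIV g = id" "inv_into UNIV g \<circ> g = id" "inv_into UNIV (inv_into UNIV g) = g"
    "g (inv_into UNIV g x) = x" "inv_into UNIV g (g x) = x"
    using surj_iff[of g] inj_iff[of g] inv_inv_eq[OF b] bij_is_surj[OF b] bij_is_inj[OF b]
    by (simp_all add: surj_f_inv_f)
qed

lemma natural_action_closed:
  assumes "g \<in> \<Gamma>" "p \<in> \<Gamma> <+> UNIV"
  shows "natural_action g p \<in> \<Gamma> <+> UNIV"
  using assms elem(5)[OF assms(1)] by (cases p) auto

section \<open>Neighbourhoods and limits in the compactification\<close>

lemma open_image_Inr:
  assumes "open U"
  shows "\<exists>T. openin mtopology T \<and> Inr ` U = T \<inter> range Inr"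
proof -
  have "embedding_map euclidean mtopology (Inr :: 'm \<Rightarrow> ('m \<Rightarrow> 'm) + 'm)"
    using compactifying by (simp add: compactifying_topology_def)
  then have "open_map euclidean (subtopology mtopology (range Inr)) (Inr :: 'm \<Rightarrow> ('m \<Rightarrow> 'm) + 'm)"
    unfolding embedding_map_def using homeomorphic_imp_open_map by fastforce
  then have "openin (subtopology mtopology (range Inr)) (Inr ` U)"
    using assms by (simp add: open_map_def)
  then show ?thesis by (auto simp: openin_subtopology)
qed

lemma continuous_map_Inr: "continuous_map euclidean mtopology Inr"
proof -
  have "embedding_map euclidean mtopology (Inr :: 'm \<Rightarrow> ('m \<Rightarrow> 'm) + 'm)"
    using compactifying by (simp add: compactifying_topology_def)
  then show ?thesis
    unfolding embedding_map_def
    using homeomorphic_imp_continuous_map continuous_map_in_subtopology by blast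
qed

lemma compactin_range_Inr: "compactin mtopology (range Inr)"
  using image_compactin[OF _ continuous_map_Inr, of UNIV] compact_UNIV by simp

lemma mball_open_Inr:
  assumes "p \<in> \<Gamma> <+> UNIV"
  shows "open {z. d p (Inr z) < e}"
proof -
  have "openin euclidean {z \<in> topspace euclidean. Inr z \<in> mball p e}"
    using openin_continuous_map_preimage[OF continuous_map_Inr openin_mball] .
  moreover have "{z \<in> topspace euclidean. Inr z \<in> mball p e} = {z. d p (Inr z) < e}"
    using assms by auto
  ultimately show ?thesis by simp
qed

lemma open_contains_mball_Inr:
  assumes "open U" "x \<in> U"
  shows "\<exists>e>0. \<forall>z. d (Inr x) (Inr z) < e \<longrightarrow> z \<in> U"
proof -
  obtain T where T: "openin mtopology T" "Inr ` U = T \<inter> range Inr"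
    using open_image_Inr[OF assms(1)] by blast
  have "Inr x \<in> T" using T(2) assms(2) by blast
  then obtain e where e: "e > 0" "mball (Inr x) e \<subseteq> T"
    using T(1) unfolding openin_mtopology by blast
  have "z \<in> U" if "d (Inr x) (Inr z) < e" for z
  proof -
    have "Inr z \<in> mball (Inr x) e" using that by simp
    then have "Inr z \<in> Inr ` U" using e(2) T(2) by blast
    then show ?thesis by auto
  qed
  then show ?thesis using e(1) by blast
qed

text \<open>The embedding only makes a singleton open relative to the copy of \<Gamma>. The copy of
  the space is compact, hence closed, and removing it gives a neighbourhood in the whole
  compactification.\<close>

lemma isolated:
  assumes g: "g \<in> \<Gamma>"
  shows "\<exists>e>0. \<forall>p\<in>\<Gamma> <+> UNIV. d (Inl g) p < e \<longrightarrow> p = Inl g"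
proof -
  have "embedding_map (discrete_topology \<Gamma>) mtopology (Inl :: _ \<Rightarrow> ('m \<Rightarrow> 'm) + 'm)"
    using compactifying by (simp add: compactifying_topology_def)
  then have "open_map (discrete_topology \<Gamma>) (subtopology mtopology (Inl ` \<Gamma>)) (Inl :: _ \<Rightarrow> ('m \<Rightarrow> 'm) + 'm)"
    unfolding embedding_map_def using homeomorphic_imp_open_map by fastforce
  then have "openin (subtopology mtopology (Inl ` \<Gamma>)) (Inl ` {g})"
    unfolding open_map_def by (rule allE[where x = "{g}"]) (use g in simp)
  then obtain T where T: "openin mtopology T" "{Inl g} = T \<inter> Inl ` \<Gamma>"
    by (auto simp: openin_subtopology)
  have "closedin mtopology (range Inr)"
    using compactin_imp_closedin[OF Hausdorff_space_mtopology compactin_range_Inr] .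
  then have "openin mtopology (T - range Inr)" using T(1) by blast
  moreover have "Inl g \<in> T - range Inr" using T(2) by blast
  ultimately obtain e where e: "e > 0" "mball (Inl g) e \<subseteq> T - range Inr"
    unfolding openin_mtopology by blast
  have "p = Inl g" if "p \<in> \<Gamma> <+> UNIV" "d (Inl g) p < e" for p
  proof -
    have "p \<in> mball (Inl g) e" using that g by simp
    then have "p \<in> T" "p \<notin> range Inr" using e(2) by blast+
    then have "p \<in> T \<inter> Inl ` \<Gamma>" using that(1) by blast
    then show ?thesis using T(2) by blast
  qed
  then show ?thesis using e(1) by blast
qed

lemma convergent_subsequence:
  fixes s :: "nat \<Rightarrow> ('m \<Rightarrow> 'm) + 'm"
  assumes "\<And>n. s n \<in> \<Gamma> <+> UNIV"
  obtains r l where "strict_mono r" "limitin mtopology (\<lambda>n. s (r n)) l sequentially"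
proof -
  have "compact_space mtopology" using compactifying by (simp add: compactifying_topology_def)
  then have "range s \<subseteq> \<Gamma> <+> UNIV \<longrightarrow>
      (\<exists>l r. l \<in> \<Gamma> <+> UNIV \<and> strict_mono r \<and> limitin mtopology (s \<circ> r) l sequentially)"
    unfolding compact_space_sequentially by (rule spec)
  moreover have "range s \<subseteq> \<Gamma> <+> UNIV" using assms by blast
  ultimately show ?thesis using that by (auto simp: comp_def)
qed

lemma limitin_eventually_less:
  assumes "limitin mtopology s l sequentially" "e > 0"
  shows "\<forall>\<^sub>F n in sequentially. d (s n) l < e"
  using assms unfolding limitin_metric by (auto elim: eventually_mono)

lemma limitin_subseq:
  fixes r :: "nat \<Rightarrow> nat"
  assumes "limitin mtopology s l sequentially" "strict_mono r"
  shows "limitin mtopology (\<lambda>n. s (r n)) l sequentially"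
  using limitin_subsequence[OF assms(2,1)] by (simp add: comp_def)

text \<open>A limit in \<Gamma> would be isolated and force the sequence to be eventually
  constant.\<close>

lemma limit_of_distinct:
  assumes "inj \<gamma>" "\<And>n. \<gamma> n \<in> \<Gamma>" "limitin mtopology (\<lambda>n. Inl (\<gamma> n)) l sequentially"
  obtains x where "l = Inr x"
proof (cases l)
  case (Inl g)
  have "l \<in> \<Gamma> <+> UNIV" using limitin_topspace[OF assms(3)] by simp
  then have "g \<in> \<Gamma>" using Inl by simp
  then obtain e where e: "e > 0" "\<And>p. p \<in> \<Gamma> <+> UNIV \<Longrightarrow> d (Inl g) p < e \<Longrightarrow> p = Inl g"
    using isolated by blast
  have "\<forall>\<^sub>F n in sequentially. \<gamma> n = g"
    using limitin_eventually_less[OF assms(3) e(1)]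
  proof eventually_elim
    case (elim n)
    then have "Inl (\<gamma> n) = (Inl g :: ('m \<Rightarrow> 'm) + 'm)"
      using e(2)[of "Inl (\<gamma> n)"] assms(2) Inl by (simp add: commute)
    then show ?case by simp
  qed
  then obtain N where "\<And>n. n \<ge> N \<Longrightarrow> \<gamma> n = g" unfolding eventually_sequentially by blast
  then have "\<gamma> N = \<gamma> (Suc N)" by simp
  then show ?thesis using assms(1) by (simp add: inj_eq)
next
  case (Inr x)
  then show ?thesis using that by blast
qed

lemma three_points: "\<exists>x y z :: 'm. x \<noteq> y \<and> y \<noteq> z \<and> x \<noteq> z"
proof -
  obtain T where "T \<subseteq> limit_set \<Gamma>" "card T = 3"
    using non_elementary infinite_arbitrarily_large[of "limit_set \<Gamma>" 3]
      obtain_subset_with_card_n[of 3 "limit_set \<Gamma>"] unfolding non_elementary_def by metis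
  then show ?thesis by (auto simp: card_3_iff)
qed

section \<open>Uniform contraction and its consequences for a subgroup\<close>

text \<open>The excluded elements are those that fail to map the complement of the
  \<open>e\<close>-ball around their inverse into the \<open>e\<close>-ball around themselves. For a
  sequence of them the convergence property gives points \<open>a\<close> and \<open>b\<close>,
  which turn out to be the limits of the elements and of their inverses; the bad points stay away
  from \<open>b\<close>, so their images tend to \<open>a\<close>, a contradiction.\<close>

lemma contraction_cofinite:
  assumes e: "e > 0"
  shows "finite {g \<in> \<Gamma>. \<exists>p\<in>\<Gamma> <+> UNIV.
    d p (Inl (inv_into UNIV g)) \<ge> e \<and> d (natural_action g p) (Inl g) \<ge> e}" (is "finite ?S")
proof (rule ccontr)
  assume "infinite ?S"
  then obtain \<gamma> :: "nat \<Rightarrow> _" where \<gamma>: "inj \<gamma>" "range \<gamma> \<subseteq> ?S"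
    using infinite_countable_subset by blast
  then have g\<Gamma>: "\<gamma> n \<in> \<Gamma>" for n by blast
  have "\<exists>p\<in>\<Gamma> <+> UNIV. d p (Inl (inv_into UNIV (\<gamma> n))) \<ge> e
      \<and> d (natural_action (\<gamma> n) p) (Inl (\<gamma> n)) \<ge> e" for n
    using \<gamma>(2) by blast
  then obtain p where p: "\<And>n. p n \<in> \<Gamma> <+> UNIV"
      "\<And>n. d (p n) (Inl (inv_into UNIV (\<gamma> n))) \<ge> e"
      "\<And>n. d (natural_action (\<gamma> n) (p n)) (Inl (\<gamma> n)) \<ge> e" by metis
  have "convergence_property mtopology \<Gamma> natural_action"
    using compactifying by (simp add: compactifying_topology_def)
  from convergence_propertyE[OF this \<gamma>(1) g\<Gamma>]
  obtain a b r where ab: "a \<in> \<Gamma> <+> UNIV" "b \<in> \<Gamma> <+> UNIV" "strict_mono r"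
    and L: "loc_unif_to_const mtopology ((\<Gamma> <+> UNIV) - {b}) (\<lambda>j. natural_action (\<gamma> (r j))) a"
    unfolding topspace_mtopology by metis
  have "Inl (inv_into UNIV (\<gamma> (r n))) \<in> \<Gamma> <+> UNIV" for n using elem(4) g\<Gamma> by simp
  then obtain r1 b' where r1: "strict_mono r1"
    and b1: "limitin mtopology (\<lambda>n. Inl (inv_into UNIV (\<gamma> (r (r1 n))))) b' sequentially"
    by (rule convergent_subsequence[of "\<lambda>n. Inl (inv_into UNIV (\<gamma> (r n)))"]) (rule that)
  obtain r2 q where r2: "strict_mono r2"
    and q: "limitin mtopology (\<lambda>n. p (r (r1 (r2 n)))) q sequentially"
    by (rule convergent_subsequence[of "\<lambda>n. p (r (r1 n))", OF p(1)]) (rule that)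
  define \<delta> where "\<delta> n = \<gamma> (r (r1 (r2 n)))" for n
  define s where "s n = p (r (r1 (r2 n)))" for n
  have \<delta>\<Gamma>: "\<delta> n \<in> \<Gamma>" for n by (simp add: \<delta>_def g\<Gamma>)
  have "inj \<delta>"
    unfolding \<delta>_def using \<gamma>(1) ab(3) r1 r2 by (auto intro!: injI simp: inj_eq strict_mono_eq)
  have b': "limitin mtopology (\<lambda>n. Inl (inv_into UNIV (\<delta> n))) b' sequentially"
    unfolding \<delta>_def by (rule limitin_subseq[OF b1 r2])
  have s: "limitin mtopology s q sequentially" unfolding s_def by (rule q)
  have L: "loc_unif_to_const mtopology ((\<Gamma> <+> UNIV) - {b}) (\<lambda>j. natural_action (\<delta> j)) a"
    unfolding \<delta>_def
    by (rule loc_unif_to_const_subseq[OF loc_unif_to_const_subseq[OF L r1] r2])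
  have op: "openin mtopology ((\<Gamma> <+> UNIV) - {c})" for c
    using t1_space_mtopology openin_topspace[of mtopology]
    unfolding topspace_mtopology t1_space_openin_delete_alt by blast
  have along: "limitin mtopology (\<lambda>n. natural_action (\<delta> n) (u n)) a sequentially"
    if "limitin mtopology u v sequentially" "v \<noteq> b" for u v
    using loc_unif_to_const_along[OF L op, of v u] that ab(1) limitin_topspace[OF that(1)] by simp
  have "b \<in> range Inr"
  proof (rule ccontr)
    assume "b \<notin> range Inr"
    then have K: "range Inr \<subseteq> (\<Gamma> <+> UNIV) - {b}" by auto
    obtain m where m: "a \<noteq> Inr m" using three_points by (metis sum.inject(2))
    have "\<forall>\<^sub>F n in sequentially. natural_action (\<delta> n) ` range Inr \<subseteq> (\<Gamma> <+> UNIV) - {Inr m}"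
      using loc_unif_to_const_compactin[OF L compactin_range_Inr K op] ab(1) m by simp
    then obtain n where n: "natural_action (\<delta> n) ` range Inr \<subseteq> (\<Gamma> <+> UNIV) - {Inr m}"
      using eventually_happens'[OF sequentially_bot] by blast
    have "natural_action (\<delta> n) (Inr (inv_into UNIV (\<delta> n) m)) = Inr m"
      using inv_simps(4)[OF \<delta>\<Gamma>] by simp
    then show False using n by (metis DiffD2 image_subset_iff rangeI singletonI)
  qed
  \<comment> \<open>The identity is a point of the compactification different from \<open>b\<close>,
    and its image under \<open>\<delta> n\<close> is \<open>\<delta> n\<close> itself.\<close>
  have "limitin mtopology (\<lambda>n. natural_action (\<delta> n) (Inl id)) a sequentially"
    using \<open>b \<in> range Inr\<close> elem(6) along[of "\<lambda>n. Inl id" "Inl id"] by auto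
  then have da: "limitin mtopology (\<lambda>n. Inl (\<delta> n)) a sequentially" by simp
  obtain a0 where a0: "a = Inr a0"
    using limit_of_distinct[OF \<open>inj \<delta>\<close> \<delta>\<Gamma> da] by blast
  \<comment> \<open>If the inverses stayed away from \<open>b\<close>, applying
    \<open>\<delta> n\<close> to them would give the constant sequence \<open>id\<close> converging
    to \<open>a\<close>, a point of the space.\<close>
  have "b' = b"
  proof (rule ccontr)
    assume "b' \<noteq> b"
    from along[OF b' this]
    have "limitin mtopology (\<lambda>n. Inl id) a sequentially"
      using inv_simps(1)[OF \<delta>\<Gamma>] by simp
    moreover have "limitin mtopology (\<lambda>n. Inl id) (Inl id) sequentially"
      using elem(6) by simp
    ultimately show False
      using limitin_metric_unique a0 by (metis Inl_Inr_False sequentially_bot)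
  qed
  have "q \<noteq> b"
  proof
    assume "q = b"
    have "\<forall>\<^sub>F n in sequentially. d (s n) b < e / 2"
      using limitin_eventually_less[OF s, of "e/2"] e \<open>q = b\<close> by simp
    moreover have "\<forall>\<^sub>F n in sequentially. d (Inl (inv_into UNIV (\<delta> n))) b < e / 2"
      using limitin_eventually_less[OF b', of "e/2"] e \<open>b' = b\<close> by simp
    ultimately have "\<forall>\<^sub>F n in sequentially. False"
    proof eventually_elim
      case (elim n)
      have "e \<le> d (s n) (Inl (inv_into UNIV (\<delta> n)))" unfolding s_def \<delta>_def using p(2) .
      also have "\<dots> \<le> d (s n) b + d b (Inl (inv_into UNIV (\<delta> n)))"
        using p(1) ab(2) elem(4)[OF \<delta>\<Gamma>] by (intro triangle) (auto simp: s_def)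
      finally show ?case using elim by (simp add: commute)
    qed
    then show False by simp
  qed
  have "\<forall>\<^sub>F n in sequentially. d (natural_action (\<delta> n) (s n)) a < e / 2"
    using limitin_eventually_less[OF along[OF s \<open>q \<noteq> b\<close>], of "e/2"] e by simp
  moreover have "\<forall>\<^sub>F n in sequentially. d (Inl (\<delta> n)) a < e / 2"
    using limitin_eventually_less[OF da, of "e/2"] e by simp
  ultimately have "\<forall>\<^sub>F n in sequentially. False"
  proof eventually_elim
    case (elim n)
    have "e \<le> d (natural_action (\<delta> n) (s n)) (Inl (\<delta> n))" unfolding s_def \<delta>_def using p(3) .
    also have "\<dots> \<le> d (natural_action (\<delta> n) (s n)) a + d a (Inl (\<delta> n))"
      using p(1) ab(1) \<delta>\<Gamma> natural_action_closed[OF \<delta>\<Gamma>] by (intro triangle) (auto simp: s_def)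
    finally show ?case using elim by (simp add: commute)
  qed
  then show False by simp
qed

text \<open>If elements of \<open>G\<close> approached \<open>x\<close>, a subsequence would have
  inverses converging to some \<open>b\<close> in the space. Contraction then makes the elements
  converge to \<open>x\<close> locally uniformly away from \<open>b\<close>, so \<open>x\<close>
  would be a limit point of \<open>G\<close>.\<close>

lemma limit_set_gap:
  assumes G: "G \<subseteq> \<Gamma>" and x: "x \<notin> limit_set G"
  shows "\<exists>\<eta>>0. \<forall>g\<in>G. \<eta> \<le> d (Inr x) (Inl g)"
proof (rule ccontr)
  assume *: "\<not> ?thesis"
  have "\<exists>g\<in>G. d (Inr x) (Inl g) < 1 / real (Suc n)" for n
  proof -
    have "\<not> (\<forall>g\<in>G. 1 / real (Suc n) \<le> d (Inr x) (Inl g))"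
      using * by (metis of_nat_0_less_iff zero_less_Suc zero_less_divide_1_iff)
    then show ?thesis by (auto simp: not_le)
  qed
  then obtain \<gamma> where \<gamma>: "\<And>n. \<gamma> n \<in> G" "\<And>n. d (Inr x) (Inl (\<gamma> n)) < 1 / real (Suc n)" by metis
  have g\<Gamma>: "\<gamma> n \<in> \<Gamma>" for n using \<gamma>(1) G by blast
  have small: "\<forall>\<^sub>F n in sequentially. d (Inr x) (Inl (\<gamma> n)) < e" if "e > 0" for e
  proof -
    have "\<forall>\<^sub>F n in sequentially. 1 / real (Suc n) < e"
      using order_tendstoD(2)[OF LIMSEQ_inverse_real_of_nat that] by (simp add: inverse_eq_divide)
    then show ?thesis by eventually_elim (use \<gamma>(2) less_trans in blast)
  qed
  \<comment> \<open>The sequence need not be injective. It still leaves every finite set, because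
    each group element has positive distance from \<open>x\<close>; this suffices for discarding the
    finitely many exceptions to contraction.\<close>
  have avoid: "\<forall>\<^sub>F n in sequentially. \<gamma> n \<noteq> f" if "f \<in> \<Gamma>" for f
  proof -
    have "d (Inr x) (Inl f) > 0" using that by simp
    from small[OF this] show ?thesis by eventually_elim auto
  qed
  have "Inl (inv_into UNIV (\<gamma> n)) \<in> \<Gamma> <+> UNIV" for n using elem(4) g\<Gamma> by simp
  then obtain r l where r: "strict_mono r"
    and l: "limitin mtopology (\<lambda>n. Inl (inv_into UNIV (\<gamma> (r n)))) l sequentially"
    by (rule convergent_subsequence[of "\<lambda>n. Inl (inv_into UNIV (\<gamma> n))"]) (rule that)
  define \<delta> where "\<delta> n = \<gamma> (r n)" for n
  have \<delta>\<Gamma>: "\<delta> n \<in> \<Gamma>" for n by (simp add: \<delta>_def g\<Gamma>)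
  have \<delta>small: "\<forall>\<^sub>F n in sequentially. d (Inr x) (Inl (\<delta> n)) < e" if "e > 0" for e
    unfolding \<delta>_def using eventually_subseq[OF r small[OF that]] .
  have \<delta>avoid: "\<forall>\<^sub>F n in sequentially. \<delta> n \<notin> F" if "finite F" "F \<subseteq> \<Gamma>" for F
  proof -
    have "\<forall>\<^sub>F n in sequentially. \<forall>f\<in>F. \<delta> n \<noteq> f"
      unfolding \<delta>_def using eventually_subseq[OF r avoid] that
      by (intro eventually_ball_finite) auto
    then show ?thesis by eventually_elim blast
  qed
  have lim: "\<forall>\<^sub>F n in sequentially. d (Inl (inv_into UNIV (\<delta> n))) l < e" if "e > 0" for e
    unfolding \<delta>_def using limitin_eventually_less[OF l that] .
  have lM: "l \<in> \<Gamma> <+> UNIV" using limitin_topspace[OF l] by simp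
  have "l \<in> range Inr"
  proof (rule ccontr)
    assume "l \<notin> range Inr"
    then obtain h where h: "l = Inl h" "h \<in> \<Gamma>" using lM by blast
    obtain e where e: "e > 0" "\<And>p. p \<in> \<Gamma> <+> UNIV \<Longrightarrow> d (Inl h) p < e \<Longrightarrow> p = Inl h"
      using isolated[OF h(2)] by blast
    have "\<forall>\<^sub>F n in sequentially. \<delta> n \<notin> {inv_into UNIV h}"
      using elem(4)[OF h(2)] by (intro \<delta>avoid) auto
    then have "\<forall>\<^sub>F n in sequentially. False"
      using lim[OF e(1)]
    proof eventually_elim
      case (elim n)
      then have "Inl (inv_into UNIV (\<delta> n)) = (Inl h :: ('m \<Rightarrow> 'm) + 'm)"
        using e(2)[of "Inl (inv_into UNIV (\<delta> n))"] elem(4)[OF \<delta>\<Gamma>] h(1) by (simp add: commute)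
      then have "\<delta> n = inv_into UNIV h" using inv_simps(3)[OF \<delta>\<Gamma>[of n]] by auto
      then show ?case using elim(1) by simp
    qed
    then show False by simp
  qed
  then obtain b where b: "l = Inr b" by blast
  have "loc_unif_to_const euclidean (UNIV - {b}) \<delta> x"
    unfolding loc_unif_to_const_def
  proof
    fix p assume "p \<in> UNIV - {b}"
    then have "d (Inr p) (Inr b) > 0" by simp
    \<comment> \<open>With a third of the distance, a point within \<open>e0\<close> of
      \<open>p\<close> is more than \<open>e0\<close> away from any inverse within \<open>e0\<close>
      of \<open>b\<close>. The resulting neighbourhood \<open>V\<close> does not depend on the
      target \<open>U\<close>, as the definition demands.\<close>
    then obtain e0 where e0: "e0 > 0" "3 * e0 = d (Inr p) (Inr b)"
      by (metis divide_pos_pos nonzero_mult_div_cancel_left times_divide_eq_right zero_less_numeral zero_neq_numeral)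
    define V where "V = {z. d (Inr p) (Inr z) < e0}"
    have "\<forall>\<^sub>F n in sequentially. \<delta> n ` (V \<inter> (UNIV - {b})) \<subseteq> U" if U: "openin euclidean U \<and> x \<in> U" for U
    proof -
      obtain e1 where e1: "e1 > 0" "\<And>z. d (Inr x) (Inr z) < e1 \<Longrightarrow> z \<in> U"
        using open_contains_mball_Inr[of U x] U by auto
      \<comment> \<open>The bound by \<open>e0\<close> makes contraction applicable on
        \<open>V\<close>; the bound by half of \<open>e1\<close> lets the two errors, from
        \<open>x\<close> to \<open>\<delta> n\<close> and from there to the image point, add up to
        less than \<open>e1\<close>.\<close>
      define e where "e = min e0 (e1 / 2)"
      have e: "e > 0" "e \<le> e0" "2 * e \<le> e1" using e0(1) e1(1) by (auto simp: e_def)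
      have "\<forall>\<^sub>F n in sequentially. \<delta> n \<notin> {g \<in> \<Gamma>. \<exists>p\<in>\<Gamma> <+> UNIV.
          d p (Inl (inv_into UNIV g)) \<ge> e \<and> d (natural_action g p) (Inl g) \<ge> e}"
        using contraction_cofinite[OF e(1)] by (rule \<delta>avoid) blast
      then show ?thesis
        using lim[OF e0(1)] \<delta>small[OF e(1)]
      proof eventually_elim
        case (elim n)
        show ?case
        proof (rule image_subsetI)
          fix z assume "z \<in> V \<inter> (UNIV - {b})"
          then have z: "d (Inr p) (Inr z) < e0" by (simp add: V_def)
          let ?i = "Inl (inv_into UNIV (\<delta> n))"
          have i: "?i \<in> \<Gamma> <+> UNIV" using elem(4)[OF \<delta>\<Gamma>] by simp
          have "d (Inr p) (Inr b) \<le> d (Inr p) (Inr z) + d (Inr z) (Inr b)"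
            by (rule triangle) auto
          moreover have "d (Inr z) (Inr b) \<le> d (Inr z) ?i + d ?i (Inr b)"
            using i by (intro triangle) auto
          ultimately have "d (Inr z) ?i \<ge> e" using z e0 elim(2) e(2) b by simp
          then have "d (natural_action (\<delta> n) (Inr z)) (Inl (\<delta> n)) < e"
            using elim(1) \<delta>\<Gamma>[of n] by (force simp: not_le)
          moreover have "d (Inr x) (Inr (\<delta> n z)) \<le> d (Inr x) (Inl (\<delta> n)) + d (Inl (\<delta> n)) (Inr (\<delta> n z))"
            using \<delta>\<Gamma> by (intro triangle) auto
          ultimately have "d (Inr x) (Inr (\<delta> n z)) < e1"
            using elim(3) e(3) by (simp add: commute)
          then show "\<delta> n z \<in> U" by (rule e1(2))
        qed
      qed
    qed
    moreover have "openin euclidean V" unfolding V_def using mball_open_Inr[of "Inr p" e0] by simp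
    moreover have "p \<in> V" unfolding V_def using e0(1) by simp
    ultimately show "\<exists>V. openin euclidean V \<and> p \<in> V \<and> (\<forall>U. openin euclidean U \<and> x \<in> U \<longrightarrow>
        (\<forall>\<^sub>F n in sequentially. \<delta> n ` (V \<inter> (UNIV - {b})) \<subseteq> U))" by blast
  qed
  moreover have "range \<delta> \<subseteq> G" unfolding \<delta>_def using \<gamma>(1) by blast
  ultimately show False using x unfolding limit_set_def by blast
qed

text \<open>If \<open>p\<close> and its image under \<open>g\<close> are both within a third of
  \<eta> of \<open>x\<close>, then they are at least that far from the inverse of \<open>g\<close>
  and from \<open>g\<close> respectively. So \<open>g\<close> is one of the finitely many exceptions
  to contraction.\<close>

lemma wandering:
  assumes G: "G \<subseteq> \<Gamma>" "\<And>g. g \<in> G \<Longrightarrow> inv_into UNIV g \<in> G"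
    and \<eta>: "\<eta> > 0" "\<And>g. g \<in> G \<Longrightarrow> \<eta> \<le> d (Inr x) (Inl g)"
  shows "finite {g \<in> G. \<exists>p\<in>\<Gamma> <+> UNIV. d (Inr x) p < \<eta> / 3 \<and> d (Inr x) (natural_action g p) < \<eta> / 3}"
proof (rule finite_subset)
  show "finite {g \<in> \<Gamma>. \<exists>p\<in>\<Gamma> <+> UNIV.
      d p (Inl (inv_into UNIV g)) \<ge> \<eta> / 3 \<and> d (natural_action g p) (Inl g) \<ge> \<eta> / 3}"
    using contraction_cofinite[of "\<eta> / 3"] \<eta>(1) by simp
  show "{g \<in> G. \<exists>p\<in>\<Gamma> <+> UNIV. d (Inr x) p < \<eta> / 3 \<and> d (Inr x) (natural_action g p) < \<eta> / 3}
    \<subseteq> {g \<in> \<Gamma>. \<exists>p\<in>\<Gamma> <+> UNIV.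
      d p (Inl (inv_into UNIV g)) \<ge> \<eta> / 3 \<and> d (natural_action g p) (Inl g) \<ge> \<eta> / 3}"
  proof clarify
    fix g p assume g: "g \<in> G" and p: "p \<in> \<Gamma> <+> UNIV" "d (Inr x) p < \<eta> / 3"
      "d (Inr x) (natural_action g p) < \<eta> / 3"
    have g\<Gamma>: "g \<in> \<Gamma>" "inv_into UNIV g \<in> \<Gamma>" using g G by blast+
    have "d (Inr x) (Inl (inv_into UNIV g)) \<le> d (Inr x) p + d p (Inl (inv_into UNIV g))"
      using p(1) g\<Gamma> by (intro triangle) auto
    then have 1: "d p (Inl (inv_into UNIV g)) \<ge> \<eta> / 3"
      using p(2) \<eta>(2)[OF G(2)[OF g]] \<eta>(1) by linarith
    have "d (Inr x) (Inl g) \<le> d (Inr x) (natural_action g p) + d (natural_action g p) (Inl g)"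
      using natural_action_closed[OF g\<Gamma>(1) p(1)] g\<Gamma> by (intro triangle) auto
    then have 2: "d (natural_action g p) (Inl g) \<ge> \<eta> / 3"
      using p(3) \<eta>(2)[OF g] \<eta>(1) by linarith
    show "g \<in> \<Gamma> \<and> (\<exists>p\<in>\<Gamma> <+> UNIV.
        d p (Inl (inv_into UNIV g)) \<ge> \<eta> / 3 \<and> d (natural_action g p) (Inl g) \<ge> \<eta> / 3)"
      using g\<Gamma>(1) p(1) 1 2 by blast
  qed
qed

section \<open>Orbits and finite covers near a limit point\<close>

text \<open>A sequence witnessing that \<open>x\<close> is a limit point attracts every point but
  one; the remaining point \<open>q\<close> is first moved elsewhere by an element that does not fix
  it.\<close>

lemma orbit_accumulates:
  assumes x: "x \<in> limit_set \<Gamma>" and W: "open W" "x \<in> W"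
  shows "\<exists>h\<in>\<Gamma>. h m \<in> W"
proof -
  obtain q \<gamma> where \<gamma>: "range \<gamma> \<subseteq> \<Gamma>" "loc_unif_to_const euclidean (UNIV - {q}) \<gamma> x"
    using x unfolding limit_set_def by blast
  have *: "\<exists>h\<in>\<Gamma>. h m \<in> W" if "m \<noteq> q" for m
  proof -
    have "limitin euclidean (\<lambda>n. \<gamma> n m) x sequentially"
      using loc_unif_to_const_pointwise[OF \<gamma>(2), of m] that by simp
    from limitinD[OF this, of W] have "\<forall>\<^sub>F n in sequentially. \<gamma> n m \<in> W" using W by simp
    then obtain n where "\<gamma> n m \<in> W" using eventually_happens'[OF sequentially_bot] by blast
    then show ?thesis using \<gamma>(1) by blast
  qed
  show ?thesis
  proof (cases "m = q")
    case True
    obtain k where k: "k \<in> \<Gamma>" "k q \<noteq> q"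
      using non_elementary_no_global_fixed_point[OF compact_UNIV convergence_group non_elementary]
      by blast
    obtain h where h: "h \<in> \<Gamma>" "h (k q) \<in> W" using *[OF k(2)] by blast
    then have "(h \<circ> k) m \<in> W" using True by simp
    then show ?thesis using elem(5)[OF h(1) k(1)] by blast
  qed (rule *)
qed

text \<open>The preimages of the ball under group elements cover the compact copy of the space,
  since every orbit enters the ball. For a finite subcover, infinitely many uncovered elements of
  \<Gamma> would accumulate at a covered point of the space.\<close>

lemma finitely_many_translates_cover:
  assumes x: "x \<in> limit_set \<Gamma>" and \<rho>: "\<rho> > 0"
  obtains H where "finite H" "H \<subseteq> \<Gamma>" "finite {g \<in> \<Gamma>. \<forall>h\<in>H. d (Inr x) (Inl (h \<circ> g)) \<ge> \<rho>}"
proof -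
  define O' where "O' h = {p \<in> \<Gamma> <+> UNIV. natural_action h p \<in> mball (Inr x) \<rho>}" for h
  have O': "openin mtopology (O' h)" if "h \<in> \<Gamma>" for h
  proof -
    have "homeomorphic_map mtopology mtopology (natural_action h)"
      using compactifying that by (simp add: compactifying_topology_def)
    then have "continuous_map mtopology mtopology (natural_action h)"
      by (rule homeomorphic_imp_continuous_map)
    then have "openin mtopology {p \<in> topspace mtopology. natural_action h p \<in> mball (Inr x) \<rho>}"
      by (rule openin_continuous_map_preimage) (rule openin_mball)
    then show ?thesis by (simp add: O'_def)
  qed
  have "range Inr \<subseteq> \<Union> (O' ` \<Gamma>)"
  proof
    fix p :: "('m \<Rightarrow> 'm) + 'm" assume "p \<in> range Inr"
    then obtain m where m: "p = Inr m" by blast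
    obtain h where "h \<in> \<Gamma>" "h m \<in> {z. d (Inr x) (Inr z) < \<rho>}"
      using orbit_accumulates[OF x mball_open_Inr[of "Inr x" \<rho>], of m] \<rho> by auto
    then show "p \<in> \<Union> (O' ` \<Gamma>)" using m by (auto simp: O'_def)
  qed
  then have "\<exists>\<F>. finite \<F> \<and> \<F> \<subseteq> O' ` \<Gamma> \<and> range Inr \<subseteq> \<Union>\<F>"
    using O' by (intro compactinD[OF compactin_range_Inr]) auto
  then obtain H where H: "finite H" "H \<subseteq> \<Gamma>" "range Inr \<subseteq> \<Union> (O' ` H)"
    by (metis finite_subset_image)
  have "finite {g \<in> \<Gamma>. \<forall>h\<in>H. d (Inr x) (Inl (h \<circ> g)) \<ge> \<rho>}" (is "finite ?S")
  proof (rule ccontr)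
    assume "infinite ?S"
    then obtain \<gamma> :: "nat \<Rightarrow> _" where \<gamma>: "inj \<gamma>" "range \<gamma> \<subseteq> ?S"
      using infinite_countable_subset by blast
    have g\<Gamma>: "\<gamma> n \<in> \<Gamma>" for n using \<gamma>(2) by blast
    have "Inl (\<gamma> n) \<in> \<Gamma> <+> UNIV" for n using g\<Gamma> by simp
    then obtain r l where r: "strict_mono r"
      and l: "limitin mtopology (\<lambda>n. Inl (\<gamma> (r n))) l sequentially"
      by (rule convergent_subsequence[of "\<lambda>n. Inl (\<gamma> n)"]) (rule that)
    have "inj (\<lambda>n. \<gamma> (r n))" using \<gamma>(1) r by (auto intro!: injI simp: inj_eq strict_mono_eq)
    then obtain z where "l = Inr z" using limit_of_distinct[OF _ g\<Gamma> l] by blast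
    then obtain h where h: "h \<in> H" "l \<in> O' h" using H(3) by blast
    have "\<forall>\<^sub>F n in sequentially. Inl (\<gamma> (r n)) \<in> O' h"
      using limitinD[OF l O' h(2)] h(1) H(2) by blast
    then obtain n where "Inl (\<gamma> (r n)) \<in> O' h"
      using eventually_happens'[OF sequentially_bot] by blast
    then have "d (Inr x) (Inl (h \<circ> \<gamma> (r n))) < \<rho>" by (simp add: O'_def)
    moreover have "\<gamma> (r n) \<in> ?S" using \<gamma>(2) by blast
    ultimately show False using h(1) by fastforce
  qed
  then show ?thesis using H(1,2) that by blast
qed

text \<open>Among three well separated points, each of \<open>p\<close> and \<open>q\<close> is
  close to at most one. The remaining point allows the magnitudes of two elements to be compared
  through the cocycle at one common point.\<close>

lemma far_from_two_points:
  obtains \<epsilon> where "\<epsilon> > 0"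
    "\<And>p q. p \<in> \<Gamma> <+> UNIV \<Longrightarrow> q \<in> \<Gamma> <+> UNIV \<Longrightarrow> \<exists>x. d (Inr x) p > \<epsilon> \<and> d (Inr x) q > \<epsilon>"
proof -
  obtain x y z :: 'm where ne: "x \<noteq> y" "y \<noteq> z" "x \<noteq> z" using three_points by blast
  define \<epsilon> where "\<epsilon> = Min {d (Inr x) (Inr y), d (Inr y) (Inr z), d (Inr x) (Inr z)} / 3"
  have \<epsilon>: "\<epsilon> > 0" "3 * \<epsilon> \<le> d (Inr x) (Inr y)" "3 * \<epsilon> \<le> d (Inr y) (Inr z)" "3 * \<epsilon> \<le> d (Inr x) (Inr z)"
    using ne by (auto simp: \<epsilon>_def)
  have near: "\<not> (d (Inr a) p \<le> \<epsilon> \<and> d (Inr b) p \<le> \<epsilon>)"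
    if "p \<in> \<Gamma> <+> UNIV" "3 * \<epsilon> \<le> d (Inr a) (Inr b)" for a b p
  proof -
    have "d (Inr a) (Inr b) \<le> d (Inr a) p + d p (Inr b)" using that(1) by (intro triangle) auto
    then show ?thesis using that(2) \<epsilon>(1) by (auto simp: commute)
  qed
  have "\<exists>x. d (Inr x) p > \<epsilon> \<and> d (Inr x) q > \<epsilon>" if "p \<in> \<Gamma> <+> UNIV" "q \<in> \<Gamma> <+> UNIV" for p q
    using near[OF that(1) \<epsilon>(2)] near[OF that(1) \<epsilon>(3)] near[OF that(1) \<epsilon>(4)]
      near[OF that(2) \<epsilon>(2)] near[OF that(2) \<epsilon>(3)] near[OF that(2) \<epsilon>(4)] by (metis not_le)
  then show ?thesis using that \<epsilon>(1) by blast
qed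

end

section \<open>The magnitude function\<close>

locale expanding_group = compactified_group \<Gamma> d
  for \<Gamma> :: "('m::metric_space \<Rightarrow> 'm) set" and d +
  fixes \<sigma> :: "('m \<Rightarrow> 'm) \<Rightarrow> 'm \<Rightarrow> real" and mag :: "('m \<Rightarrow> 'm) \<Rightarrow> real"
  assumes coarse_cocycle: "coarse_cocycle \<Gamma> \<sigma>"
    and magnitude: "magnitude_function \<Gamma> d \<sigma> mag"
begin

lemma magnitude_bounds:
  assumes "\<epsilon> > 0"
  obtains C where "C > 0"
    "\<And>g x. g \<in> \<Gamma> \<Longrightarrow> d (Inr x) (Inl (inv_into UNIV g)) > \<epsilon> \<Longrightarrow> mag g - C \<le> \<sigma> g x \<and> \<sigma> g x \<le> mag g + C"
proof -
  have "\<exists>C>0. \<forall>x. \<forall>g\<in>\<Gamma>. d (Inr x) (Inl (inv\<^bsub>homeo_group\<^esub> g)) > \<epsilon> \<longrightarrow>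
        mag g - C \<le> \<sigma> g x \<and> \<sigma> g x \<le> mag g + C"
    using magnitude assms unfolding magnitude_function_def by blast
  then show ?thesis using that elem(3) by metis
qed

lemma cocycle_subadditive:
  obtains \<kappa> where "\<And>g h x. g \<in> \<Gamma> \<Longrightarrow> h \<in> \<Gamma> \<Longrightarrow> \<sigma> (g \<circ> h) x \<le> \<sigma> g (h x) + \<sigma> h x + \<kappa>"
proof -
  obtain \<kappa> where "kappa_coarse_cocycle \<Gamma> \<kappa> \<sigma>" using coarse_cocycle unfolding coarse_cocycle_def by blast
  then have "\<bar>\<sigma> (g \<circ> h) x - (\<sigma> g (h x) + \<sigma> h x)\<bar> \<le> \<kappa>" if "g \<in> \<Gamma>" "h \<in> \<Gamma>" for g h x
    using that unfolding kappa_coarse_cocycle_def by blast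
  then have "\<sigma> (g \<circ> h) x \<le> \<sigma> g (h x) + \<sigma> h x + \<kappa>" if "g \<in> \<Gamma>" "h \<in> \<Gamma>" for g h x
    using that by (smt (verit))
  then show ?thesis using that by blast
qed

text \<open>Coarse continuity bounds the cocycle near each point, and compactness leaves finitely
  many local bounds.\<close>

lemma cocycle_bounded_above:
  assumes g: "g \<in> \<Gamma>"
  obtains B where "\<And>x. \<sigma> g x \<le> B"
proof -
  obtain \<kappa> where k: "kappa_coarse_cocycle \<Gamma> \<kappa> \<sigma>" using coarse_cocycle unfolding coarse_cocycle_def by blast
  have "\<exists>S. open S \<and> y \<in> S \<and> (\<forall>x\<in>S. \<sigma> g x \<le> \<sigma> g y + (\<bar>\<kappa>\<bar> + 1))" for y
  proof -
    have "Limsup (at y) (\<lambda>x. ereal \<bar>\<sigma> g y - \<sigma> g x\<bar>) \<le> ereal \<kappa>"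
      using k g unfolding kappa_coarse_cocycle_def by blast
    then have "\<forall>B>ereal \<kappa>. \<forall>\<^sub>F x in at y. ereal \<bar>\<sigma> g y - \<sigma> g x\<bar> < B"
      by (simp only: Limsup_le_iff)
    from spec[OF this, of "ereal (\<bar>\<kappa>\<bar> + 1)"]
    have "\<forall>\<^sub>F x in at y. ereal \<bar>\<sigma> g y - \<sigma> g x\<bar> < ereal (\<bar>\<kappa>\<bar> + 1)" by simp
    then obtain S where S: "open S" "y \<in> S" "\<And>x. x \<in> S \<Longrightarrow> x \<noteq> y \<Longrightarrow> \<bar>\<sigma> g y - \<sigma> g x\<bar> < \<bar>\<kappa>\<bar> + 1"
      unfolding eventually_at_topological by auto
    \<comment> \<open>The limit superior does not see \<open>y\<close> itself; the absolute value of
      \<kappa> keeps the error term positive, so the bound holds there too.\<close>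
    have "\<sigma> g x \<le> \<sigma> g y + (\<bar>\<kappa>\<bar> + 1)" if "x \<in> S" for x
      using S(3)[OF that] by (cases "x = y") auto
    then show ?thesis using S(1,2) by blast
  qed
  then obtain S where S: "\<And>y. open (S y)" "\<And>y. y \<in> S y"
      "\<And>x y. x \<in> S y \<Longrightarrow> \<sigma> g x \<le> \<sigma> g y + (\<bar>\<kappa>\<bar> + 1)" by metis
  obtain T where T: "finite T" "UNIV \<subseteq> (\<Union>y\<in>T. S y)"
    using compactE_image[OF compact_UNIV, of UNIV S] S(1,2) by (metis UNIV_I UN_iff subsetI)
  \<comment> \<open>The sum of absolute values serves as a common upper bound for the finitely many
    values at the centres.\<close>
  have "\<sigma> g x \<le> (\<Sum>y\<in>T. \<bar>\<sigma> g y\<bar>) + (\<bar>\<kappa>\<bar> + 1)" for x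
  proof -
    obtain y where y: "y \<in> T" "x \<in> S y" using T(2) by blast
    have "\<bar>\<sigma> g y\<bar> \<le> (\<Sum>y\<in>T. \<bar>\<sigma> g y\<bar>)" using T(1) y(1) by (intro member_le_sum) auto
    then show ?thesis using S(3)[OF y(2)] by linarith
  qed
  then show ?thesis using that by blast
qed

text \<open>At a point far from the inverses of both \<open>g\<close> and
  \<open>h \<circ> g\<close>, their magnitudes are cocycle values up to a constant, and the cocycle
  rule adds only a value of \<open>\<sigma> h\<close>, which is bounded above independently of
  \<open>g\<close>.\<close>

lemma magnitude_left_translate:
  assumes h: "h \<in> \<Gamma>"
  shows "\<exists>C. \<forall>g\<in>\<Gamma>. mag (h \<circ> g) \<le> mag g + C"
proof -
  obtain \<epsilon> where \<epsilon>: "\<epsilon> > 0"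
    "\<And>p q. p \<in> \<Gamma> <+> UNIV \<Longrightarrow> q \<in> \<Gamma> <+> UNIV \<Longrightarrow> \<exists>x. d (Inr x) p > \<epsilon> \<and> d (Inr x) q > \<epsilon>"
    by (rule far_from_two_points) (rule that; blast)
  obtain C where C: "C > 0" "\<And>g x. g \<in> \<Gamma> \<Longrightarrow> d (Inr x) (Inl (inv_into UNIV g)) > \<epsilon> \<Longrightarrow>
      mag g - C \<le> \<sigma> g x \<and> \<sigma> g x \<le> mag g + C"
    by (rule magnitude_bounds[OF \<epsilon>(1)]) (rule that; blast)
  obtain \<kappa> where \<kappa>: "\<And>g h x. g \<in> \<Gamma> \<Longrightarrow> h \<in> \<Gamma> \<Longrightarrow> \<sigma> (g \<circ> h) x \<le> \<sigma> g (h x) + \<sigma> h x + \<kappa>"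
    by (rule cocycle_subadditive) (rule that; blast)
  obtain B where B: "\<And>x. \<sigma> h x \<le> B" by (rule cocycle_bounded_above[OF h]) (rule that; blast)
  have "mag (h \<circ> g) \<le> mag g + (B + 2 * C + \<kappa>)" if g: "g \<in> \<Gamma>" for g
  proof -
    obtain x where x: "d (Inr x) (Inl (inv_into UNIV g)) > \<epsilon>" "d (Inr x) (Inl (inv_into UNIV (h \<circ> g))) > \<epsilon>"
      using \<epsilon>(2)[of "Inl (inv_into UNIV g)" "Inl (inv_into UNIV (h \<circ> g))"] elem(4) elem(5)[OF h g] g
      by auto
    show ?thesis
      using C(2)[OF g x(1)] C(2)[OF elem(5)[OF h g] x(2)] \<kappa>[OF h g, of x] B[of "g x"] by linarith
  qed
  then show ?thesis by blast
qed

text \<open>Choose \<open>x\<close> far from the inverses of \<open>c\<close> and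
  \<open>g \<circ> c\<close>. Contraction puts \<open>c x\<close> near \<open>c\<close>, hence near
  \<open>y\<close> and away from the inverse of \<open>g\<close>, so all three cocycle values are
  magnitudes up to a constant independent of \<open>g\<close> and \<open>c\<close>.\<close>

lemma magnitude_subadditive_near:
  assumes G: "G \<subseteq> \<Gamma>" "\<And>g. g \<in> G \<Longrightarrow> inv_into UNIV g \<in> G"
    and \<eta>: "\<eta> > 0" "\<And>g. g \<in> G \<Longrightarrow> \<eta> \<le> d (Inr y) (Inl g)"
  shows "\<exists>F C. finite F \<and> (\<forall>g\<in>G. \<forall>c\<in>\<Gamma> - F. d (Inr y) (Inl c) < \<eta> / 3 \<longrightarrow>
      mag (g \<circ> c) \<le> mag g + mag c + C)"
proof -
  obtain \<epsilon> where \<epsilon>: "\<epsilon> > 0"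
    "\<And>p q. p \<in> \<Gamma> <+> UNIV \<Longrightarrow> q \<in> \<Gamma> <+> UNIV \<Longrightarrow> \<exists>x. d (Inr x) p > \<epsilon> \<and> d (Inr x) q > \<epsilon>"
    by (rule far_from_two_points) (rule that; blast)
  obtain C1 where C1: "C1 > 0" "\<And>g x. g \<in> \<Gamma> \<Longrightarrow> d (Inr x) (Inl (inv_into UNIV g)) > \<epsilon> \<Longrightarrow>
      mag g - C1 \<le> \<sigma> g x \<and> \<sigma> g x \<le> mag g + C1"
    by (rule magnitude_bounds[OF \<epsilon>(1)]) (rule that; blast)
  \<comment> \<open>The inverse of \<open>g\<close> is at least \<eta> from \<open>y\<close>, while
    \<open>c x\<close> is less than two thirds of \<eta> away. The remaining distance exceeds a
    third of \<eta>, so a quarter is a safe threshold.\<close>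
  have "\<eta> / 4 > 0" using \<eta>(1) by simp
  then obtain C2 where C2: "C2 > 0" "\<And>g x. g \<in> \<Gamma> \<Longrightarrow> d (Inr x) (Inl (inv_into UNIV g)) > \<eta> / 4 \<Longrightarrow>
      mag g - C2 \<le> \<sigma> g x \<and> \<sigma> g x \<le> mag g + C2"
    by (rule magnitude_bounds) (rule that; blast)
  obtain \<kappa> where \<kappa>: "\<And>g h x. g \<in> \<Gamma> \<Longrightarrow> h \<in> \<Gamma> \<Longrightarrow> \<sigma> (g \<circ> h) x \<le> \<sigma> g (h x) + \<sigma> h x + \<kappa>"
    by (rule cocycle_subadditive) (rule that; blast)
  \<comment> \<open>The bound by \<epsilon> places \<open>x\<close> outside the excluded ball around
    the inverse of \<open>c\<close>; the bound by a third of \<eta> controls the distance from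
    \<open>c x\<close> to \<open>c\<close>.\<close>
  define e where "e = min \<epsilon> (\<eta> / 3)"
  have e: "e > 0" "e \<le> \<epsilon>" "e \<le> \<eta> / 3" using \<epsilon>(1) \<eta>(1) by (auto simp: e_def)
  define F where "F = {g \<in> \<Gamma>. \<exists>p\<in>\<Gamma> <+> UNIV.
    d p (Inl (inv_into UNIV g)) \<ge> e \<and> d (natural_action g p) (Inl g) \<ge> e}"
  have "finite F" unfolding F_def by (rule contraction_cofinite[OF e(1)])
  moreover have "mag (g \<circ> c) \<le> mag g + mag c + (2 * C1 + C2 + \<kappa>)"
    if g: "g \<in> G" and c: "c \<in> \<Gamma> - F" and near: "d (Inr y) (Inl c) < \<eta> / 3" for g c
  proof -
    have g\<Gamma>: "g \<in> \<Gamma>" and c\<Gamma>: "c \<in> \<Gamma>" and ig: "inv_into UNIV g \<in> G" "inv_into UNIV g \<in> \<Gamma>"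
      using g c G by blast+
    obtain x where x: "d (Inr x) (Inl (inv_into UNIV c)) > \<epsilon>" "d (Inr x) (Inl (inv_into UNIV (g \<circ> c))) > \<epsilon>"
      using \<epsilon>(2)[of "Inl (inv_into UNIV c)" "Inl (inv_into UNIV (g \<circ> c))"]
        elem(4)[OF c\<Gamma>] elem(4)[OF elem(5)[OF g\<Gamma> c\<Gamma>]] by auto
    have "\<not> (e \<le> d (Inr x) (Inl (inv_into UNIV c)) \<and> e \<le> d (natural_action c (Inr x)) (Inl c))"
      using c points_simps(2)[of x] unfolding F_def by blast
    then have "d (natural_action c (Inr x)) (Inl c) < e" using x(1) e(2) by linarith
    moreover have "d (Inr y) (Inl (inv_into UNIV g)) \<le> d (Inr y) (Inl c) + d (Inl c) (Inl (inv_into UNIV g))"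
      using c\<Gamma> ig by (intro triangle) auto
    moreover have "d (Inl c) (Inl (inv_into UNIV g)) \<le> d (Inl c) (Inr (c x)) + d (Inr (c x)) (Inl (inv_into UNIV g))"
      using c\<Gamma> ig by (intro triangle) auto
    ultimately have "d (Inr (c x)) (Inl (inv_into UNIV g)) > \<eta> / 4"
      using near e(3) \<eta>(1) \<eta>(2)[OF ig(1)] by (simp add: commute)
    from C2(2)[OF g\<Gamma> this] show ?thesis
      using C1(2)[OF c\<Gamma> x(1)] C1(2)[OF elem(5)[OF g\<Gamma> c\<Gamma>] x(2)] \<kappa>[OF g\<Gamma> c\<Gamma>, of x] by linarith
  qed
  ultimately show ?thesis by blast
qed

end

section \<open>Poincare series\<close>

text \<open>Subadditivity compares each product of two terms with the term of the composition. A
  composition is hit at most \<open>card T\<close> times: its left factor determines the pair by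
  injectivity, and all left factors lie in one translate of \<open>T\<close>.\<close>

lemma sum_product_le_multiplicity:
  fixes mag :: "('a \<Rightarrow> 'a) \<Rightarrow> real"
  assumes A: "finite A" "A \<subseteq> G" and D: "finite D" "D \<subseteq> B" and T: "finite T" and s: "s \<ge> 0"
    and closed: "\<And>g c. g \<in> G \<Longrightarrow> c \<in> B \<Longrightarrow> g \<circ> c \<in> \<Gamma>"
    and sub: "\<And>g c. g \<in> G \<Longrightarrow> c \<in> B \<Longrightarrow> mag (g \<circ> c) \<le> mag g + mag c + C"
    and inj: "\<And>g. g \<in> G \<Longrightarrow> inj g"
    and mult: "\<And>g c g' c'. g \<in> G \<Longrightarrow> g' \<in> G \<Longrightarrow> c \<in> B \<Longrightarrow> c' \<in> B \<Longrightarrow> g \<circ> c = g' \<circ> c' \<Longrightarrow>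
      \<exists>t\<in>T. g' = g \<circ> t"
    and summ: "(\<lambda>f. exp (- s * mag f)) summable_on \<Gamma>"
  shows "(\<Sum>g\<in>A. exp (- s * mag g)) * (\<Sum>c\<in>D. exp (- s * mag c))
    \<le> real (card T) * exp (s * C) * infsum (\<lambda>f. exp (- s * mag f)) \<Gamma>"
proof -
  let ?u = "\<lambda>f. exp (- s * mag f)"
  let ?m = "\<lambda>(g, c). g \<circ> c :: 'a \<Rightarrow> 'a"
  have fiber: "card {p \<in> A \<times> D. ?m p = z} \<le> card T" for z
  proof (cases "{p \<in> A \<times> D. ?m p = z} = {}")
    case False
    then obtain g0 c0 where 0: "g0 \<in> A" "c0 \<in> D" "g0 \<circ> c0 = z" by auto
    have "inj_on fst {p \<in> A \<times> D. ?m p = z}"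
    proof (rule inj_onI, clarsimp)
      fix g c c' assume "g \<in> A" "g \<circ> c' = g \<circ> c"
      then show "c = c'" using inj[of g] A(2) by (metis fun.inj_map_strong injD subsetD)
    qed
    moreover have "fst ` {p \<in> A \<times> D. ?m p = z} \<subseteq> (\<circ>) g0 ` T"
    proof clarsimp
      fix g c assume "g \<in> A" "c \<in> D" "z = g \<circ> c"
      then show "g \<in> (\<circ>) g0 ` T" using mult[of g0 g c0 c] 0 A(2) D(2) by blast
    qed
    ultimately have "card {p \<in> A \<times> D. ?m p = z} \<le> card ((\<circ>) g0 ` T)"
      using T by (intro card_inj_on_le) auto
    then show ?thesis using card_image_le[OF T, of "(\<circ>) g0"] by linarith
  qed (metis card.empty le0)
  have img: "(\<Sum>z\<in>?m ` (A \<times> D). ?u z) \<le> infsum ?u \<Gamma>"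
  proof (rule finite_sum_le_infsum[OF summ])
    show "finite (?m ` (A \<times> D))" using A(1) D(1) by blast
    show "?m ` (A \<times> D) \<subseteq> \<Gamma>" using A(2) D(2) closed by auto
  qed simp
  have "(\<Sum>p\<in>A \<times> D. ?u (?m p)) = (\<Sum>z\<in>?m ` (A \<times> D). real (card {p \<in> A \<times> D. ?m p = z}) * ?u z)"
    using A(1) D(1) by (subst sum.image_gen[where g = ?m]) auto
  also have "\<dots> \<le> (\<Sum>z\<in>?m ` (A \<times> D). real (card T) * ?u z)"
    using fiber by (intro sum_mono mult_right_mono) auto
  also have "\<dots> = real (card T) * (\<Sum>z\<in>?m ` (A \<times> D). ?u z)" by (simp add: sum_distrib_left)
  also have "\<dots> \<le> real (card T) * infsum ?u \<Gamma>" by (intro mult_left_mono img) simp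
  finally have 1: "exp (s * C) * (\<Sum>p\<in>A \<times> D. ?u (?m p)) \<le> exp (s * C) * (real (card T) * infsum ?u \<Gamma>)"
    by (intro mult_left_mono) simp_all
  have "(\<Sum>g\<in>A. ?u g) * (\<Sum>c\<in>D. ?u c) = (\<Sum>p\<in>A \<times> D. ?u (fst p) * ?u (snd p))"
    by (simp add: sum_product sum.cartesian_product case_prod_unfold)
  also have "\<dots> \<le> (\<Sum>p\<in>A \<times> D. exp (s * C) * ?u (?m p))"
  proof (rule sum_mono)
    fix p assume "p \<in> A \<times> D"
    then obtain g c where p: "p = (g, c)" "g \<in> G" "c \<in> B" using A(2) D(2) by auto
    have "s * mag (g \<circ> c) \<le> s * (mag g + mag c + C)" using sub[OF p(2,3)] s by (rule mult_left_mono)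
    then show "?u (fst p) * ?u (snd p) \<le> exp (s * C) * ?u (?m p)"
      by (simp add: p(1) algebra_simps flip: exp_add)
  qed
  also have "\<dots> = exp (s * C) * (\<Sum>p\<in>A \<times> D. ?u (?m p))" by (simp add: sum_distrib_left)
  finally have "(\<Sum>g\<in>A. ?u g) * (\<Sum>c\<in>D. ?u c) \<le> exp (s * C) * (\<Sum>p\<in>A \<times> D. ?u (?m p))" .
  from order_trans[OF this 1] show ?thesis by (simp add: ac_simps)
qed

text \<open>Every element outside \<open>F\<close> is charged to a translate of it in
  \<open>B\<close>. For a fixed \<open>h\<close> the charging is injective and changes each term by
  a bounded factor, so each \<open>h\<close> costs at most a multiple of the series over
  \<open>B\<close>.\<close>

lemma infsum_le_of_finite_cover:
  fixes mag :: "('a \<Rightarrow> 'a) \<Rightarrow> real"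
  assumes F: "finite F" and H: "finite H" and s: "s \<ge> 0"
    and cover: "\<And>f. f \<in> \<Gamma> \<Longrightarrow> f \<in> F \<or> (\<exists>h\<in>H. h \<circ> f \<in> B)"
    and trans: "\<And>h f. h \<in> H \<Longrightarrow> f \<in> \<Gamma> \<Longrightarrow> mag (h \<circ> f) \<le> mag f + C"
    and inj: "\<And>h. h \<in> H \<Longrightarrow> inj h"
    and summ: "(\<lambda>f. exp (- s * mag f)) summable_on \<Gamma>" and B: "B \<subseteq> \<Gamma>"
  shows "infsum (\<lambda>f. exp (- s * mag f)) \<Gamma> \<le> (\<Sum>f\<in>F. exp (- s * mag f))
    + real (card H) * exp (s * C) * infsum (\<lambda>f. exp (- s * mag f)) B"
proof (rule infsum_le_finite_sums[OF summ])
  let ?u = "\<lambda>f. exp (- s * mag f)"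
  have sB: "?u summable_on B" using summable_on_subset_banach[OF summ B] .
  fix D assume D: "finite D" "D \<subseteq> \<Gamma>"
  have each: "(\<Sum>f | f \<in> D \<and> h \<circ> f \<in> B. ?u f) \<le> exp (s * C) * infsum ?u B" if h: "h \<in> H" for h
  proof -
    let ?D = "{f \<in> D. h \<circ> f \<in> B}"
    have "(\<Sum>f\<in>?D. ?u f) \<le> (\<Sum>f\<in>?D. exp (s * C) * ?u (h \<circ> f))"
    proof (rule sum_mono)
      fix f assume "f \<in> ?D"
      then have "s * mag (h \<circ> f) \<le> s * (mag f + C)" using D(2) s by (intro mult_left_mono trans[OF h]) auto
      then show "?u f \<le> exp (s * C) * ?u (h \<circ> f)" by (simp add: algebra_simps flip: exp_add)
    qed
    also have "\<dots> = exp (s * C) * (\<Sum>z\<in>(\<circ>) h ` ?D. ?u z)"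
    proof -
      have "inj_on ((\<circ>) h) ?D" using inj_on_subset[OF fun.inj_map[OF inj[OF h]] subset_UNIV] .
      then show ?thesis by (simp add: sum.reindex sum_distrib_left)
    qed
    also have "(\<Sum>z\<in>(\<circ>) h ` ?D. ?u z) \<le> infsum ?u B"
      using D(1) by (intro finite_sum_le_infsum[OF sB]) auto
    finally show ?thesis by (simp add: mult_left_mono)
  qed
  have "(\<Sum>f\<in>D. ?u f) \<le> (\<Sum>f\<in>D. (if f \<in> F then ?u f else 0) + (\<Sum>h\<in>H. if h \<circ> f \<in> B then ?u f else 0))"
  proof (rule sum_mono)
    fix f assume f: "f \<in> D"
    have nn: "0 \<le> (\<Sum>h\<in>H. if h \<circ> f \<in> B then ?u f else 0)" by (intro sum_nonneg) auto
    show "?u f \<le> (if f \<in> F then ?u f else 0) + (\<Sum>h\<in>H. if h \<circ> f \<in> B then ?u f else 0)"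
    proof (cases "f \<in> F")
      case False
      then obtain h where h: "h \<in> H" "h \<circ> f \<in> B" using cover f D(2) by blast
      have "(if h \<circ> f \<in> B then ?u f else 0) \<le> (\<Sum>h\<in>H. if h \<circ> f \<in> B then ?u f else 0)"
        using H h(1) by (intro member_le_sum) auto
      then show ?thesis using h(2) False by simp
    qed (use nn in simp)
  qed
  also have "\<dots> = (\<Sum>f\<in>D \<inter> F. ?u f) + (\<Sum>h\<in>H. \<Sum>f | f \<in> D \<and> h \<circ> f \<in> B. ?u f)"
    unfolding sum.distrib sum.swap[of _ D H] sum.inter_restrict[OF D(1)] sum.inter_filter[OF D(1)]
    by (rule refl)
  also have "\<dots> \<le> (\<Sum>f\<in>F. ?u f) + (\<Sum>h\<in>H. exp (s * C) * infsum ?u B)"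
    using F each by (intro add_mono sum_mono2 sum_mono) auto
  finally show "(\<Sum>f\<in>D. ?u f) \<le> (\<Sum>f\<in>F. ?u f) + real (card H) * exp (s * C) * infsum ?u B"
    by (simp add: ac_simps)
qed

text \<open>The two preceding estimates are chained and the positive series over \<open>B\<close> is
  cancelled. The bound that remains involves no infinite series and is continuous in
  \<open>s\<close>, even where the series over \<Gamma> may blow up.\<close>

lemma partial_sum_bound:
  fixes mag :: "('a \<Rightarrow> 'a) \<Rightarrow> real"
  assumes A: "finite A" "A \<subseteq> G" and T: "finite T" and F: "finite F" and H: "finite H" and s: "s \<ge> 0"
    and closed: "\<And>g c. g \<in> G \<Longrightarrow> c \<in> B \<Longrightarrow> g \<circ> c \<in> \<Gamma>"
    and sub: "\<And>g c. g \<in> G \<Longrightarrow> c \<in> B \<Longrightarrow> mag (g \<circ> c) \<le> mag g + mag c + C"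
    and injG: "\<And>g. g \<in> G \<Longrightarrow> inj g"
    and mult: "\<And>g c g' c'. g \<in> G \<Longrightarrow> g' \<in> G \<Longrightarrow> c \<in> B \<Longrightarrow> c' \<in> B \<Longrightarrow> g \<circ> c = g' \<circ> c' \<Longrightarrow>
      \<exists>t\<in>T. g' = g \<circ> t"
    and cover: "\<And>f. f \<in> \<Gamma> \<Longrightarrow> f \<in> F \<or> (\<exists>h\<in>H. h \<circ> f \<in> B)"
    and trans: "\<And>h f. h \<in> H \<Longrightarrow> f \<in> \<Gamma> \<Longrightarrow> mag (h \<circ> f) \<le> mag f + C'"
    and injH: "\<And>h. h \<in> H \<Longrightarrow> inj h"
    and summ: "(\<lambda>f. exp (- s * mag f)) summable_on \<Gamma>" and B: "B \<subseteq> \<Gamma>" and b: "b \<in> B"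
  shows "(\<Sum>g\<in>A. exp (- s * mag g))
    \<le> real (card T) * exp (s * C) * ((\<Sum>f\<in>F. exp (- s * mag f)) * exp (s * mag b) + real (card H) * exp (s * C'))"
proof -
  let ?u = "\<lambda>f. exp (- s * mag f)"
  let ?S = "\<Sum>g\<in>A. ?u g" and ?K = "real (card T) * exp (s * C)" and ?P = "infsum ?u B"
    and ?F = "\<Sum>f\<in>F. ?u f"
  have sB: "?u summable_on B" using summable_on_subset_banach[OF summ B] .
  have P: "exp (- s * mag b) \<le> ?P"
    using finite_sum_le_infsum[OF sB, of "{b}"] b by simp
  then have Ppos: "?P > 0" by (smt (verit) exp_gt_zero)
  have "?S * ?P = infsum (\<lambda>f. ?S * ?u f) B" by (rule infsum_cmult_right[symmetric]) (use sB in simp)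
  also have "\<dots> \<le> ?K * infsum ?u \<Gamma>"
  proof (rule infsum_le_finite_sums)
    show "(\<lambda>f. ?S * ?u f) summable_on B" using sB by (rule summable_on_cmult_right)
    fix D assume "finite D" "D \<subseteq> B"
    then show "(\<Sum>f\<in>D. ?S * ?u f) \<le> ?K * infsum ?u \<Gamma>"
      unfolding sum_distrib_left[symmetric]
      by (intro sum_product_le_multiplicity[OF A _ _ T s closed sub injG mult summ])
  qed
  also have "\<dots> \<le> ?K * (?F + real (card H) * exp (s * C') * ?P)"
    by (intro mult_left_mono infsum_le_of_finite_cover[OF F H s cover trans injH summ B]) auto
  \<comment> \<open>The term of \<open>b\<close> bounds the series over \<open>B\<close> from below,
    so the additive contribution of \<open>F\<close> can be absorbed into a multiple of that series
    and cancelled with the rest.\<close>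
  also have "?F \<le> ?F * exp (s * mag b) * ?P"
  proof -
    have "1 = exp (s * mag b) * exp (- s * mag b)" by (simp flip: exp_add)
    also have "\<dots> \<le> exp (s * mag b) * ?P" by (intro mult_left_mono P) auto
    finally have "?F * 1 \<le> ?F * (exp (s * mag b) * ?P)" by (intro mult_left_mono sum_nonneg) auto
    then show ?thesis by (simp add: mult.assoc)
  qed
  finally have "?S * ?P \<le> ?K * (?F * exp (s * mag b) * ?P + real (card H) * exp (s * C') * ?P)"
    by (simp add: mult_left_mono)
  also have "\<dots> = ?K * (?F * exp (s * mag b) + real (card H) * exp (s * C')) * ?P"
    by (simp add: algebra_simps)
  finally show ?thesis using Ppos by simp
qed

section \<open>Summability and the extended-valued series\<close>

lemma summable_on_of_poincare_series:
  assumes "poincare_series mag \<Gamma> s < \<infinity>"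
  shows "(\<lambda>f. exp (- s * mag f)) summable_on \<Gamma>"
proof (rule nonneg_bdd_above_summable_on)
  let ?P = "poincare_series mag \<Gamma> s"
  have "(\<Sum>f\<in>D. exp (- s * mag f)) \<le> enn2real ?P" if D: "finite D" "D \<subseteq> \<Gamma>" for D
  proof -
    have "ennreal (\<Sum>f\<in>D. exp (- s * mag f)) = (\<Sum>f\<in>D. ennreal (exp (- s * mag f)))"
      by (simp add: sum_ennreal)
    also have "\<dots> \<le> ?P"
      unfolding poincare_series_def nonneg_infsum_complete[OF zero_le] using D by (intro SUP_upper) auto
    also have "\<dots> = ennreal (enn2real ?P)" using assms by (simp add: less_top)
    finally show ?thesis by simp
  qed
  then show "bdd_above (sum (\<lambda>f. exp (- s * mag f)) ` {D. D \<subseteq> \<Gamma> \<and> finite D})"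
    by (intro bdd_aboveI2) auto
qed simp

text \<open>Terms of negative magnitude grow with the exponent, but each contributes at least 1 to
  the convergent series at \<open>t\<close>, so there are finitely many. All other terms
  decrease.\<close>

lemma summable_on_exponent_mono:
  fixes mag :: "'a \<Rightarrow> real"
  assumes summ: "(\<lambda>f. exp (- t * mag f)) summable_on \<Gamma>" and t: "0 < t" "t \<le> s"
  shows "(\<lambda>f. exp (- s * mag f)) summable_on \<Gamma>"
proof -
  let ?Z = "{f \<in> \<Gamma>. mag f < 0}"
  have "finite ?Z"
  proof (rule ccontr)
    assume inf: "infinite ?Z"
    let ?P = "infsum (\<lambda>f. exp (- t * mag f)) \<Gamma>"
    \<comment> \<open>The size is chosen to exceed the value of the series at
      \<open>t\<close>.\<close>
    obtain D where D: "D \<subseteq> ?Z" "finite D" "card D = Suc (nat \<lceil>?P\<rceil>)"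
      using infinite_arbitrarily_large[OF inf] by blast
    have "real (card D) = (\<Sum>f\<in>D. 1)" by simp
    also have "\<dots> \<le> (\<Sum>f\<in>D. exp (- t * mag f))"
      using D(1) t(1) by (intro sum_mono) (auto simp: mult_le_0_iff)
    also have "\<dots> \<le> ?P" using D by (intro finite_sum_le_infsum[OF summ]) auto
    finally show False using D(3) by linarith
  qed
  have "(\<lambda>f. exp (- s * mag f)) summable_on (\<Gamma> - ?Z)"
  proof (rule summable_on_comparison_test)
    show "(\<lambda>f. exp (- t * mag f)) summable_on (\<Gamma> - ?Z)"
      using summable_on_subset_banach[OF summ] by blast
    fix f assume "f \<in> \<Gamma> - ?Z"
    then show "exp (- s * mag f) \<le> exp (- t * mag f)" using t by (auto intro: mult_right_mono)
  qed simp
  moreover have "(\<lambda>f. exp (- s * mag f)) summable_on ?Z" using \<open>finite ?Z\<close> by simp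
  ultimately have "(\<lambda>f. exp (- s * mag f)) summable_on ((\<Gamma> - ?Z) \<union> ?Z)"
    by (intro summable_on_union)
  moreover have "(\<Gamma> - ?Z) \<union> ?Z = \<Gamma>" by blast
  ultimately show ?thesis by simp
qed

lemma poincare_series_mono:
  assumes "G \<subseteq> \<Gamma>"
  shows "poincare_series mag G s \<le> poincare_series mag \<Gamma> s"
  unfolding poincare_series_def nonneg_infsum_complete[OF zero_le]
  using assms by (intro SUP_subset_mono) auto

lemma poincare_series_le:
  assumes "\<And>A. finite A \<Longrightarrow> A \<subseteq> G \<Longrightarrow> (\<Sum>g\<in>A. exp (- s * mag g)) \<le> K"
  shows "poincare_series mag G s \<le> ennreal K"
  unfolding poincare_series_def nonneg_infsum_complete[OF zero_le]
proof (rule SUP_least)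
  fix A assume "A \<in> {F. finite F \<and> F \<subseteq> G}"
  then have "(\<Sum>g\<in>A. exp (- s * mag g)) \<le> K" using assms by blast
  then have "ennreal (\<Sum>g\<in>A. exp (- s * mag g)) \<le> ennreal K" by (rule ennreal_leI)
  then show "(\<Sum>g\<in>A. ennreal (exp (- s * mag g))) \<le> ennreal K" by (simp add: sum_ennreal)
qed

section \<open>Finiteness of the subgroup series at the endpoint\<close>

context expanding_group
begin

text \<open>Convergence for \<Gamma> is assumed only strictly above \<open>s0\<close>, yet the
  conclusion for \<open>G\<close> includes \<open>s0\<close>: partial sums over \<open>G\<close>
  obey a bound that stays finite as \<open>s\<close> decreases to \<open>s0\<close>.\<close>

lemma poincare_series_subgroup_finite:
  assumes G: "G \<subseteq> \<Gamma>" "\<And>g. g \<in> G \<Longrightarrow> inv_into UNIV g \<in> G" "\<And>g h. g \<in> G \<Longrightarrow> h \<in> G \<Longrightarrow> g \<circ> h \<in> G"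
    and x: "x \<in> limit_set \<Gamma>" "x \<notin> limit_set G"
    and s0: "s0 \<ge> 0" and summ: "\<And>s. s > s0 \<Longrightarrow> (\<lambda>f. exp (- s * mag f)) summable_on \<Gamma>"
  shows "poincare_series mag G s0 < \<infinity>"
proof -
  obtain \<eta> where \<eta>: "\<eta> > 0" "\<And>g. g \<in> G \<Longrightarrow> \<eta> \<le> d (Inr x) (Inl g)"
    using limit_set_gap[OF G(1) x(2)] by blast
  obtain F0 C where F0: "finite F0" and C: "\<And>g c. g \<in> G \<Longrightarrow> c \<in> \<Gamma> - F0 \<Longrightarrow> d (Inr x) (Inl c) < \<eta> / 3 \<Longrightarrow>
      mag (g \<circ> c) \<le> mag g + mag c + C"
    using magnitude_subadditive_near[OF G(1,2) \<eta>] by blast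
  have "\<eta> / 3 > 0" using \<eta>(1) by simp
  then obtain H where H: "finite H" "H \<subseteq> \<Gamma>"
    and F1: "finite {g \<in> \<Gamma>. \<forall>h\<in>H. d (Inr x) (Inl (h \<circ> g)) \<ge> \<eta> / 3}"
    by (rule finitely_many_translates_cover[OF x(1)]) (rule that)
  define B where "B = {c \<in> \<Gamma> - F0. d (Inr x) (Inl c) < \<eta> / 3}"
  define T where "T = {g \<in> G. \<exists>p\<in>\<Gamma> <+> UNIV. d (Inr x) p < \<eta> / 3 \<and> d (Inr x) (natural_action g p) < \<eta> / 3}"
  \<comment> \<open>Besides the uncovered elements, \<open>F\<close> collects those that some
    \<open>h\<close> moves into \<open>F0\<close>, where subadditivity may fail; these come from
    finitely many preimages.\<close>
  define F where "F = {g \<in> \<Gamma>. \<forall>h\<in>H. d (Inr x) (Inl (h \<circ> g)) \<ge> \<eta> / 3} \<union> (\<Union>h\<in>H. (\<circ>) (inv_into UNIV h) ` F0)"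
  have T: "finite T" unfolding T_def by (rule wandering[OF G(1,2) \<eta>])
  have F: "finite F" unfolding F_def using F1 H(1) F0 by blast
  have B: "B \<subseteq> \<Gamma>" unfolding B_def by blast
  have cover: "f \<in> F \<or> (\<exists>h\<in>H. h \<circ> f \<in> B)" if f: "f \<in> \<Gamma>" for f
  proof (rule disjCI)
    assume "\<not> (\<exists>h\<in>H. h \<circ> f \<in> B)"
    show "f \<in> F"
    proof (cases "\<forall>h\<in>H. d (Inr x) (Inl (h \<circ> f)) \<ge> \<eta> / 3")
      case True
      then show ?thesis unfolding F_def using f by blast
    next
      case False
      then obtain h where h: "h \<in> H" "d (Inr x) (Inl (h \<circ> f)) < \<eta> / 3" by (auto simp: not_le)
      have h\<Gamma>: "h \<in> \<Gamma>" using h(1) H(2) by blast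
      have "h \<circ> f \<in> F0"
        using h elem(5)[OF h\<Gamma> f] \<open>\<not> (\<exists>h\<in>H. h \<circ> f \<in> B)\<close> unfolding B_def by blast
      moreover have "f = inv_into UNIV h \<circ> (h \<circ> f)"
        using inv_simps(2)[OF h\<Gamma>] by (metis comp_assoc id_comp)
      ultimately show ?thesis unfolding F_def using h(1) by blast
    qed
  qed
  have "\<forall>h\<in>H. \<exists>C. \<forall>f\<in>\<Gamma>. mag (h \<circ> f) \<le> mag f + C"
    using magnitude_left_translate H(2) by blast
  then obtain c where c: "\<And>h f. h \<in> H \<Longrightarrow> f \<in> \<Gamma> \<Longrightarrow> mag (h \<circ> f) \<le> mag f + c h" by metis
  \<comment> \<open>One constant dominating the individual constants of all translates in
    \<open>H\<close>.\<close>
  define C' where "C' = (\<Sum>h\<in>H. \<bar>c h\<bar>)"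
  have trans: "mag (h \<circ> f) \<le> mag f + C'" if "h \<in> H" "f \<in> \<Gamma>" for h f
  proof -
    have "\<bar>c h\<bar> \<le> C'" unfolding C'_def using H(1) that(1) by (intro member_le_sum) auto
    then show ?thesis using c[OF that] by linarith
  qed
  have mult: "\<exists>t\<in>T. g' = g \<circ> t"
    if "g \<in> G" "g' \<in> G" "c \<in> B" "c' \<in> B" "g \<circ> c = g' \<circ> c'" for g c g' c'
  proof -
    have g\<Gamma>: "g \<in> \<Gamma>" using that(1) G(1) by blast
    \<comment> \<open>This quotient moves \<open>c'\<close> to \<open>c\<close>, and both lie in the
      small ball around \<open>x\<close>, so it is one of the finitely many elements of
      \<open>T\<close>.\<close>
    let ?t = "inv_into UNIV g \<circ> g'"
    have "g' = g \<circ> ?t" using inv_simps(1)[OF g\<Gamma>] by (metis comp_assoc id_comp)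
    moreover have "?t \<circ> c' = c"
      using inv_simps(2)[OF g\<Gamma>] that(5) by (metis comp_assoc id_comp)
    then have "natural_action ?t (Inl c') = Inl c" by simp
    then have "?t \<in> T"
      unfolding T_def using G(2,3) that(1-4) unfolding B_def by (auto intro!: bexI[of _ "Inl c'"])
    ultimately show ?thesis by blast
  qed
  show ?thesis
  \<comment> \<open>The bound on partial sums uses an element of \<open>B\<close>; if there is none,
    the cover forces \<Gamma> to be finite.\<close>
  proof (cases "B = {}")
    case True
    then have "\<Gamma> \<subseteq> F" using cover by blast
    then have "finite G" using F G(1) by (meson finite_subset)
    then have "poincare_series mag G s0 \<le> ennreal (\<Sum>g\<in>G. exp (- s0 * mag g))"
      by (intro poincare_series_le sum_mono2) auto
    then show ?thesis using ennreal_less_top le_less_trans by (metis infinity_ennreal_def)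
  next
    case False
    then obtain b where b: "b \<in> B" by blast
    define \<phi> where "\<phi> s = real (card T) * exp (s * C) *
      ((\<Sum>f\<in>F. exp (- s * mag f)) * exp (s * mag b) + real (card H) * exp (s * C'))" for s
    have "(\<Sum>g\<in>A. exp (- s0 * mag g)) \<le> \<phi> s0" if A: "finite A" "A \<subseteq> G" for A
    \<comment> \<open>For a fixed finite \<open>A\<close> both sides are continuous in
      \<open>s\<close>, so the inequality survives the limit from the right.\<close>
    proof (rule tendsto_le)
      show "at_right s0 \<noteq> bot" by simp
      show "(\<phi> \<longlongrightarrow> \<phi> s0) (at_right s0)" unfolding \<phi>_def by (intro tendsto_intros)
      show "((\<lambda>s. \<Sum>g\<in>A. exp (- s * mag g)) \<longlongrightarrow> (\<Sum>g\<in>A. exp (- s0 * mag g))) (at_right s0)"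
        by (intro tendsto_intros)
      show "\<forall>\<^sub>F s in at_right s0. (\<Sum>g\<in>A. exp (- s * mag g)) \<le> \<phi> s"
        using eventually_at_right_less[of s0]
      proof eventually_elim
        case (elim s)
        show ?case
          unfolding \<phi>_def
        proof (rule partial_sum_bound[OF A T F H(1) _ _ _ _ mult cover trans _ summ[OF elim] B b])
          show "s \<ge> 0" using elim s0 by simp
          show "g \<circ> c \<in> \<Gamma>" if "g \<in> G" "c \<in> B" for g c
            using that G(1) B elem(5) by blast
          show "mag (g \<circ> c) \<le> mag g + mag c + C" if "g \<in> G" "c \<in> B" for g c
            using C[OF that(1)] that(2) unfolding B_def by blast
          show "inj g" if "g \<in> G" for g using elem(1)[of g] that G(1) by (auto simp: bij_def)
          show "inj h" if "h \<in> H" for h using elem(1)[of h] that H(2) by (auto simp: bij_def)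
        qed
      qed
    qed
    then have "poincare_series mag G s0 \<le> ennreal (\<phi> s0)" by (rule poincare_series_le)
    then show ?thesis using ennreal_less_top le_less_trans by (metis infinity_ennreal_def)
  qed
qed

end

theorem theorem4p3:
  fixes \<Gamma> G :: "('m::metric_space \<Rightarrow> 'm) set"
    and d :: "('m \<Rightarrow> 'm) + 'm \<Rightarrow> ('m \<Rightarrow> 'm) + 'm \<Rightarrow> real"
    and \<sigma> :: "('m \<Rightarrow> 'm) \<Rightarrow> 'm \<Rightarrow> real"
    and mag :: "('m \<Rightarrow> 'm) \<Rightarrow> real"
  assumes "compact (UNIV :: 'm set)"
    and "convergence_group \<Gamma>"
    and "non_elementary \<Gamma>"
    and "compatible_metric \<Gamma> d"
    and "expanding_coarse_cocycle \<Gamma> d \<sigma>"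
    and "magnitude_function \<Gamma> d \<sigma> mag"
    and "critical_exponent mag \<Gamma> < \<infinity>"
    and "subgroup G homeo_group"
    and "G \<subseteq> \<Gamma>"
    and "limit_set G \<subset> limit_set \<Gamma>"
    and "poincare_series mag G (real_of_ereal (critical_exponent mag G)) = \<infinity>"
  shows "critical_exponent mag G < critical_exponent mag \<Gamma>"
proof (rule ccontr)
  assume "\<not> critical_exponent mag G < critical_exponent mag \<Gamma>"
  then have le: "critical_exponent mag \<Gamma> \<le> critical_exponent mag G" by simp
  interpret expanding_group \<Gamma> d \<sigma> mag
    using assms(1-6) by unfold_locales (auto simp: expanding_coarse_cocycle_def)
  have "critical_exponent mag G \<le> critical_exponent mag \<Gamma>"
    unfolding critical_exponent_def
    using le_less_trans[OF poincare_series_mono[OF assms(9)]] by (intro Inf_superset_mono) blast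
  then have fin: "critical_exponent mag G < \<infinity>" using assms(7) by (rule le_less_trans)
  have "0 \<le> critical_exponent mag G"
    unfolding critical_exponent_def by (rule Inf_greatest) auto
  \<comment> \<open>Being finite and nonnegative, the exponent is a real number, so
    \<open>real_of_ereal\<close> in the divergence hypothesis returns its true value and not the
    default for infinities.\<close>
  then obtain \<delta> where \<delta>: "critical_exponent mag G = ereal \<delta>" "\<delta> \<ge> 0"
    using fin by (cases "critical_exponent mag G") auto
  obtain x where x: "x \<in> limit_set \<Gamma>" "x \<notin> limit_set G" using assms(10) by blast
  have G: "inv_into UNIV g \<in> G" "g \<circ> h \<in> G" if "g \<in> G" "h \<in> G" for g h
    using subgroup.m_inv_closed[OF assms(8) that(1)] elem(3)[of g] assms(9) that
      subgroup.m_closed[OF assms(8) that] by (auto simp: homeo_group_def)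
  have "poincare_series mag G \<delta> < \<infinity>"
  proof (rule poincare_series_subgroup_finite[OF assms(9) _ _ x \<delta>(2)])
    fix s assume "s > \<delta>"
    then have "critical_exponent mag \<Gamma> < ereal s" using le \<delta>(1) by (metis ereal_less_eq(3) le_less_trans less_ereal.simps(1))
    \<comment> \<open>The infimum supplies an exponent of convergence below \<open>s\<close>, from
      which summability is carried up to \<open>s\<close>.\<close>
    then obtain t where t: "t > 0" "poincare_series mag \<Gamma> t < \<infinity>" "t < s"
      unfolding critical_exponent_def Inf_less_iff by auto
    show "(\<lambda>f. exp (- s * mag f)) summable_on \<Gamma>"
      using summable_on_exponent_mono[OF summable_on_of_poincare_series[OF t(2)] t(1)] t(3) by simp
  qed (use G in blast)+
  then show False using assms(11) \<delta>(1) by simp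
qed

end
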